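(* Let $f$ be a supersymmetric function, i.e. $f\in\Gamma$. Then $$\mathbb{E}_n[f]=\sum_{\lambda\in\mathcal{SP}_n}\frac{2^{n-\ell(\lambda)}(g^\lambda)^2}{n!}\,f(\lambda_1,\lambda_2,\dots,\lambda_{\ell(\lambda)})$$ is a polynomial function in $n$: there is a polynomial $\Phi_f$ such that $\mathbb{E}_n[f]=\Phi_f(n)$ for all integers $n\ge 0$.
   Context: A partition is a finite weakly decreasing sequence $\lambda=(\lambda_1,\dots,\lambda_l)$ of positive integers; $\ell(\lambda)=l$ is its length and $|\lambda|=\sum_i\lambda_i$ its size. It is strict if all parts are distinct. $\mathcal{SP}_n$ denotes the set of strict partitions of $n$ (with $\mathcal{SP}_0=\{\emptyset\}$). The shifted Young diagram of a strict $\lambda$ is $S(\lambda)=\{(i,j)\in\mathbb{Z}^2: 1\le i\le\ell(\lambda),\ i\le j\le\lambda_i+i-1\}$. $g^\lambda$ is the number of sequences $\emptyset=\lambda^{(0)},\lambda^{(1)},\dots,\lambda^{(|\lambda|)}=\lambda$ of strict partitions such that each $S(\lambda^{(i)})$ is obtained from $S(\lambda^{(i-1)})$ by adding exactly one box. $p_r=x_1^r+x_2^r+\cdots$ denotes the $r$-th power-sum symmetric function, and $\Gamma$ is the subalgebra (over $\mathbb{Q}$) of the algebra of symmetric functions generated by $p_1,p_3,p_5,\dots$; its elements are called supersymmetric functions. For $f\in\Gamma$ and a strict partition $\lambda$, $f(\lambda_1,\dots,\lambda_{\ell(\lambda)})$ means $f$ evaluated at $x_i=\lambda_i$ for $i\le\ell(\lambda)$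 and $x_i=0$ for $i>\ell(\lambda)$. *)

theory Defs
  imports
    "HOL-Library.Poly_Mapping"
    "HOL-Computational_Algebra.Polynomial"
begin

section \<open>Strict partitions and shifted diagrams\<close>

definition is_partition :: "nat list \<Rightarrow> bool" where
  "is_partition \<mu> \<longleftrightarrow> sorted_wrt (\<ge>) \<mu> \<and> (\<forall>k\<in>set \<mu>. k > 0)"

definition strict_partition :: "nat list \<Rightarrow> bool" where
  "strict_partition \<mu> \<longleftrightarrow> is_partition \<mu> \<and> distinct \<mu>"

definition SP :: "nat \<Rightarrow> nat list set" where
  "SP n = {\<mu>. strict_partition \<mu> \<and> sum_list \<mu> = n}"

text \<open>
  Since \<open>\<lambda>\<close> is reserved, partitions are written \<open>\<mu>\<close>.
  Lists are indexed from 0, so the (1-based) part \<open>\<mu>\<^sub>i\<close> is \<open>\<mu> ! (i - 1)\<close>.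
\<close>

definition shifted_diagram :: "nat list \<Rightarrow> (int \<times> int) set" where
  "shifted_diagram \<mu> =
     {(i, j). 1 \<le> i \<and> i \<le> int (length \<mu>) \<and> i \<le> j \<and> j \<le> int (\<mu> ! nat (i - 1)) + i - 1}"

definition shifted_chains :: "nat list \<Rightarrow> nat list list set" where
  "shifted_chains \<mu> =
     {c. length c = sum_list \<mu> + 1 \<and> c ! 0 = [] \<and> c ! sum_list \<mu> = \<mu> \<and>
         (\<forall>i \<le> sum_list \<mu>. strict_partition (c ! i)) \<and>
         (\<forall>i < sum_list \<mu>. \<exists>b. b \<notin> shifted_diagram (c ! i) \<and>
            shifted_diagram (c ! Suc i) = insert b (shifted_diagram (c ! i)))}"

definition g_num :: "nat list \<Rightarrow> nat" where
  "g_num \<mu> = card (shifted_chains \<mu>)"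


section \<open>Symmetric functions\<close>

text \<open>
  A monomial in the variables \<open>x\<^sub>0, x\<^sub>1, x\<^sub>2, \<dots>\<close> is a finitely supported exponent vector, and a
  formal power series in these infinitely many variables is its coefficient function.
\<close>

type_synonym monomial = "nat \<Rightarrow>\<^sub>0 nat"
type_synonym series = "monomial \<Rightarrow> rat"

definition mono_degree :: "monomial \<Rightarrow> nat" where
  "mono_degree m = (\<Sum>i\<in>Poly_Mapping.keys m. Poly_Mapping.lookup m i)"

definition series_const :: "rat \<Rightarrow> series" where
  "series_const c = (\<lambda>m. if m = 0 then c else 0)"

definition series_add :: "series \<Rightarrow> series \<Rightarrow> series" where
  "series_add f g = (\<lambda>m. f m + g m)"

definition series_mult :: "series \<Rightarrow> series \<Rightarrow> series" where
  "series_mult f g = (\<lambda>m. \<Sum>(a, b)\<in>{(a, b). a + b = m}. f a * g b)"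

definition symmetric_functions :: "series set" where
  "symmetric_functions =
     {f. (\<exists>d. \<forall>m. f m \<noteq> 0 \<longrightarrow> mono_degree m \<le> d) \<and>
         (\<forall>\<pi>. bij \<pi> \<longrightarrow> (\<forall>m. f (Poly_Mapping.map_key \<pi> m) = f m))}"

text \<open>Meaningful for \<open>r > 0\<close> only.\<close>

definition power_sum :: "nat \<Rightarrow> series" where
  "power_sum r = (\<lambda>m. if \<exists>i. m = Poly_Mapping.single i r then 1 else 0)"

inductive_set Gamma :: "series set" where
  const: "series_const c \<in> Gamma"
| power_sum: "odd r \<Longrightarrow> power_sum r \<in> Gamma"
| add: "f \<in> Gamma \<Longrightarrow> g \<in> Gamma \<Longrightarrow> series_add f g \<in> Gamma"
| mult: "f \<in> Gamma \<Longrightarrow> g \<in> Gamma \<Longrightarrow> series_mult f g \<in> Gamma"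

text \<open>
  Evaluation at a finitely supported sequence. \<^const>\<open>Sum_any\<close> sums over the monomials with
  nonzero contribution; for series of bounded degree there are only finitely many of these
  (see \<open>finite_evaluation\<close> below).
\<close>

definition evaluate :: "series \<Rightarrow> (nat \<Rightarrow> rat) \<Rightarrow> rat" where
  "evaluate f x = Sum_any (\<lambda>m. f m * (\<Prod>i\<in>Poly_Mapping.keys m. x i ^ Poly_Mapping.lookup m i))"

definition eval_at_partition :: "series \<Rightarrow> nat list \<Rightarrow> rat" where
  "eval_at_partition f \<mu> =
     evaluate f (\<lambda>i. if i < length \<mu> then of_nat (\<mu> ! i) else 0)"

definition expectation :: "nat \<Rightarrow> series \<Rightarrow> rat" where
  "expectation n f =
     (\<Sum>\<mu>\<in>SP n. 2 ^ (n - length \<mu>) * of_nat (g_num \<mu>) ^ 2 / fact n * eval_at_partition f \<mu>)"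


section \<open>Well-definedness\<close>

text \<open>
  The sums and cardinalities above range over finite sets, so no default values intervene, and the
  truncated subtraction in the exponent \<open>n - length \<mu>\<close> is a genuine one.
\<close>

lemma length_le_sum_list:
  "(\<forall>k\<in>set \<mu>. 0 < k) \<Longrightarrow> length \<mu> \<le> sum_list (\<mu> :: nat list)"
  by (induction \<mu>) (auto simp: Suc_le_eq)

lemma length_le_size: "\<mu> \<in> SP n \<Longrightarrow> length \<mu> \<le> n"
  using length_le_sum_list by (auto simp: SP_def strict_partition_def is_partition_def)

lemma finite_SP: "finite (SP n)"
proof (rule finite_subset)
  show "SP n \<subseteq> {xs. set xs \<subseteq> {..n} \<and> length xs \<le> n}"
    using length_le_size by (auto simp: SP_def member_le_sum_list)
  show "finite {xs. set xs \<subseteq> {..n} \<and> length xs \<le> n}"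
    by (rule finite_lists_length_le) simp
qed

lemma shifted_diagram_subset_bounds:
  assumes "\<forall>k\<in>set \<nu>. 0 < k" and "shifted_diagram \<nu> \<subseteq> shifted_diagram \<mu>"
  shows "length \<nu> \<le> length \<mu>" and "set \<nu> \<subseteq> {..sum_list \<mu>}"
proof -
  have *: "i < length \<mu> \<and> \<nu> ! i \<le> \<mu> ! i" if "i < length \<nu>" for i
  proof -
    have "0 < \<nu> ! i" using assms(1) that by simp
    then have "(int i + 1, int (\<nu> ! i) + int i) \<in> shifted_diagram \<nu>"
      using that by (auto simp: shifted_diagram_def)
    then have "(int i + 1, int (\<nu> ! i) + int i) \<in> shifted_diagram \<mu>"
      using assms(2) by blast
    then show ?thesis by (auto simp: shifted_diagram_def)
  qed
  show "length \<nu> \<le> length \<mu>" using * by (meson not_le less_irrefl)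
  show "set \<nu> \<subseteq> {..sum_list \<mu>}"
  proof
    fix k assume "k \<in> set \<nu>"
    then obtain i where "i < length \<nu>" "k = \<nu> ! i" by (metis in_set_conv_nth)
    with * have "k \<le> \<mu> ! i" "\<mu> ! i \<in> set \<mu>" by auto
    then show "k \<in> {..sum_list \<mu>}" using member_le_sum_list le_trans by fastforce
  qed
qed

lemma finite_shifted_chains: "finite (shifted_chains \<mu>)"
proof (rule finite_subset)
  let ?P = "{xs. set xs \<subseteq> {..sum_list \<mu>} \<and> length xs \<le> length \<mu>}"
  show "finite {c. set c \<subseteq> ?P \<and> length c = sum_list \<mu> + 1}"
    by (intro finite_lists_length_eq finite_lists_length_le) simp
  show "shifted_chains \<mu> \<subseteq> {c. set c \<subseteq> ?P \<and> length c = sum_list \<mu> + 1}"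
  proof
    fix c assume c: "c \<in> shifted_chains \<mu>"
    have sub: "shifted_diagram (c ! i) \<subseteq> shifted_diagram \<mu>" if "i \<le> sum_list \<mu>" for i
      using that
    proof (induction i rule: inc_induct)
      case base
      then show ?case using c by (simp add: shifted_chains_def)
    next
      case (step i)
      then show ?case using c by (force simp: shifted_chains_def)
    qed
    have "c ! i \<in> ?P" if i: "i < length c" for i
    proof -
      have le: "i \<le> sum_list \<mu>" using i c by (simp add: shifted_chains_def)
      then have "\<forall>k\<in>set (c ! i). 0 < k"
        using c by (auto simp: shifted_chains_def strict_partition_def is_partition_def)
      from shifted_diagram_subset_bounds[OF this sub[OF le]] show ?thesis by simp
    qed
    then have "\<forall>\<nu>\<in>set c. \<nu> \<in> ?P" unfolding all_set_conv_all_nth by blast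
    then have "set c \<subseteq> ?P" by (rule subset_code(1)[THEN iffD2])
    then show "c \<in> {c. set c \<subseteq> ?P \<and> length c = sum_list \<mu> + 1}"
      using c by (simp add: shifted_chains_def)
  qed
qed

lemma finite_bounded_monomials:
  assumes "finite K"
  shows "finite {m :: monomial. Poly_Mapping.keys m \<subseteq> K \<and> (\<forall>i. Poly_Mapping.lookup m i \<le> N)}"
proof (rule finite_imageD)
  show "inj_on Poly_Mapping.lookup {m :: monomial. Poly_Mapping.keys m \<subseteq> K \<and> (\<forall>i. Poly_Mapping.lookup m i \<le> N)}"
    by (simp add: inj_on_def poly_mapping_eqI)
  have "Poly_Mapping.lookup ` {m :: monomial. Poly_Mapping.keys m \<subseteq> K \<and> (\<forall>i. Poly_Mapping.lookup m i \<le> N)}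
      \<subseteq> {h. \<forall>i. (i \<in> K \<longrightarrow> h i \<in> {..N}) \<and> (i \<notin> K \<longrightarrow> h i = 0)}"
    by (auto simp: subset_iff in_keys_iff)
  then show "finite (Poly_Mapping.lookup ` {m :: monomial. Poly_Mapping.keys m \<subseteq> K \<and> (\<forall>i. Poly_Mapping.lookup m i \<le> N)})"
    by (rule finite_subset) (intro finite_set_of_finite_funs assms finite_atMost)
qed

lemma lookup_le_mono_degree: "Poly_Mapping.lookup m i \<le> mono_degree m"
  by (cases "i \<in> Poly_Mapping.keys m") (auto simp: mono_degree_def in_keys_iff intro: member_le_sum)

lemma finite_splittings: "finite {(a, b). a + b = (m :: monomial)}"
proof -
  let ?B = "{a :: monomial. Poly_Mapping.keys a \<subseteq> Poly_Mapping.keys m \<and> (\<forall>i. Poly_Mapping.lookup a i \<le> mono_degree m)}"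
  have *: "a \<in> ?B" if "a + b = m" for a b
  proof -
    have le: "Poly_Mapping.lookup a i \<le> Poly_Mapping.lookup m i" for i
      using that by (auto simp: lookup_add)
    moreover have "Poly_Mapping.keys a \<subseteq> Poly_Mapping.keys m"
    proof
      fix i assume "i \<in> Poly_Mapping.keys a"
      then show "i \<in> Poly_Mapping.keys m" using le[of i] by (simp add: in_keys_iff)
    qed
    ultimately show ?thesis using lookup_le_mono_degree le_trans by blast
  qed
  have "{(a, b). a + b = m} \<subseteq> ?B \<times> ?B"
  proof (rule subsetI)
    fix p assume "p \<in> {(a, b). a + b = m}"
    then have "fst p + snd p = m" "snd p + fst p = m" by (auto simp: add.commute)
    from this[THEN *] show "p \<in> ?B \<times> ?B" by (subst mem_Times_iff) (rule conjI)
  qed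
  moreover have "finite (?B \<times> ?B)" by (intro finite_cartesian_product finite_bounded_monomials) auto
  ultimately show ?thesis by (rule finite_subset)
qed

lemma finite_evaluation:
  assumes "f \<in> symmetric_functions" and "finite {i. x i \<noteq> 0}"
  shows "finite {m. f m * (\<Prod>i\<in>Poly_Mapping.keys m. x i ^ Poly_Mapping.lookup m i) \<noteq> 0}"
proof -
  obtain d where d: "\<And>m. f m \<noteq> 0 \<Longrightarrow> mono_degree m \<le> d"
    using assms(1) by (auto simp: symmetric_functions_def)
  have "{m. f m * (\<Prod>i\<in>Poly_Mapping.keys m. x i ^ Poly_Mapping.lookup m i) \<noteq> 0}
      \<subseteq> {m. Poly_Mapping.keys m \<subseteq> {i. x i \<noteq> 0} \<and> (\<forall>i. Poly_Mapping.lookup m i \<le> d)}"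
  proof safe
    fix m i
    assume "f m * (\<Prod>i\<in>Poly_Mapping.keys m. x i ^ Poly_Mapping.lookup m i) \<noteq> 0" and "i \<in> Poly_Mapping.keys m" and "x i = 0"
    then show False by (auto simp: in_keys_iff)
  next
    fix m i
    assume "f m * (\<Prod>i\<in>Poly_Mapping.keys m. x i ^ Poly_Mapping.lookup m i) \<noteq> 0"
    then have "mono_degree m \<le> d" using d by auto
    then show "Poly_Mapping.lookup m i \<le> d" using lookup_le_mono_degree le_trans by blast
  qed
  then show ?thesis using finite_bounded_monomials[OF assms(2)] finite_subset by blast
qed

lemma mono_degree_add: "mono_degree (a + b) = mono_degree a + mono_degree b"
proof -
  have *: "mono_degree c = (\<Sum>i\<in>Poly_Mapping.keys a \<union> Poly_Mapping.keys b. Poly_Mapping.lookup c i)" if "Poly_Mapping.keys c \<subseteq> Poly_Mapping.keys a \<union> Poly_Mapping.keys b" for c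
    unfolding mono_degree_def using that
    by (intro sum.mono_neutral_left) (auto simp: in_keys_iff)
  have "Poly_Mapping.keys (a + b) \<subseteq> Poly_Mapping.keys a \<union> Poly_Mapping.keys b" by (rule Poly_Mapping.keys_add)
  then show ?thesis by (simp add: * lookup_add sum.distrib)
qed

lemma map_key_map_key_inv:
  assumes "bij \<pi>"
  shows "Poly_Mapping.map_key \<pi> (Poly_Mapping.map_key (inv \<pi>) m) = m"
    and "Poly_Mapping.map_key (inv \<pi>) (Poly_Mapping.map_key \<pi> m) = m"
  using assms
  by (auto intro!: poly_mapping_eqI simp: map_key.rep_eq bij_is_inj bij_imp_bij_inv
      bij_is_surj surj_f_inv_f inv_f_f)

lemma series_mult_symmetric:
  assumes "f \<in> symmetric_functions" and "g \<in> symmetric_functions"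
  shows "series_mult f g \<in> symmetric_functions"
proof -
  obtain d where d: "\<And>m. f m \<noteq> 0 \<Longrightarrow> mono_degree m \<le> d"
    using assms(1) by (auto simp: symmetric_functions_def)
  obtain e where e: "\<And>m. g m \<noteq> 0 \<Longrightarrow> mono_degree m \<le> e"
    using assms(2) by (auto simp: symmetric_functions_def)
  have "mono_degree m \<le> d + e" if "series_mult f g m \<noteq> 0" for m
  proof -
    have "\<exists>p\<in>{(a, b). a + b = m}. (case p of (a, b) \<Rightarrow> f a * g b) \<noteq> 0"
      using that unfolding series_mult_def by (meson sum.neutral)
    then obtain a b where "a + b = m" "f a \<noteq> 0" "g b \<noteq> 0" by auto
    then show ?thesis using d[of a] e[of b] mono_degree_add[of a b] by simp
  qed
  moreover have "series_mult f g (Poly_Mapping.map_key \<pi> m) = series_mult f g m"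
    if bij: "bij \<pi>" for \<pi> m
  proof -
    let ?k = "Poly_Mapping.map_key \<pi>" and ?l = "Poly_Mapping.map_key (inv \<pi>)"
    note inj = bij_is_inj[OF bij] bij_is_inj[OF bij_imp_bij_inv[OF bij]]
    note inv = map_key_map_key_inv[OF bij]
    have sym: "f (?k a) = f a" "g (?k a) = g a" for a
      using assms bij by (auto simp: symmetric_functions_def)
    show ?thesis unfolding series_mult_def
      by (rule sum.reindex_bij_witness[where i = "\<lambda>(a, b). (?k a, ?k b)"
            and j = "\<lambda>(a, b). (?l a, ?l b)"])
        (auto simp: inv sym map_key_plus[OF inj(1), symmetric] map_key_plus[OF inj(2), symmetric], 
         metis inv(1) sym)
  qed
  ultimately show ?thesis unfolding symmetric_functions_def by blast
qed

theorem Gamma_subset_symmetric_functions: "Gamma \<subseteq> symmetric_functions"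
proof
  fix f assume "f \<in> Gamma"
  then show "f \<in> symmetric_functions"
  proof induction
    case (const c)
    have "Poly_Mapping.map_key \<pi> m = 0 \<longleftrightarrow> m = 0" if "bij \<pi>" for \<pi> :: "nat \<Rightarrow> nat" and m :: monomial
      by (metis that map_key_map_key_inv(2) map_key_zero bij_is_inj bij_imp_bij_inv)
    then show ?case
      by (auto simp: symmetric_functions_def series_const_def intro!: exI[of _ "mono_degree 0"])
  next
    case (power_sum r)
    have deg: "mono_degree (Poly_Mapping.single i r) \<le> r" for i
      by (simp add: mono_degree_def)
    have "(\<exists>i. Poly_Mapping.map_key \<pi> m = Poly_Mapping.single i r) \<longleftrightarrow>
        (\<exists>i. m = Poly_Mapping.single i r)" if bij: "bij \<pi>" for \<pi> :: "nat \<Rightarrow> nat" and m :: monomial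
    proof
      assume "\<exists>i. Poly_Mapping.map_key \<pi> m = Poly_Mapping.single i r"
      then obtain i where "Poly_Mapping.map_key \<pi> m = Poly_Mapping.single i r" ..
      moreover have "Poly_Mapping.single i r = Poly_Mapping.map_key \<pi> (Poly_Mapping.single (\<pi> i) r)"
        using bij by (simp add: bij_is_inj map_key_single)
      ultimately show "\<exists>i. m = Poly_Mapping.single i r"
        by (metis map_key_map_key_inv(2)[OF bij])
    next
      assume "\<exists>i. m = Poly_Mapping.single i r"
      then obtain i where "m = Poly_Mapping.single (\<pi> (inv \<pi> i)) r"
        using bij by (auto simp: bij_is_surj surj_f_inv_f)
      then show "\<exists>i. Poly_Mapping.map_key \<pi> m = Poly_Mapping.single i r"
        using bij map_key_single[of \<pi>] by (auto simp: bij_is_inj)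
    qed
    then show ?case using deg
      by (auto simp: symmetric_functions_def power_sum_def intro!: exI[of _ r])
  next
    case (add f g)
    then obtain d e where "\<And>m. f m \<noteq> 0 \<Longrightarrow> mono_degree m \<le> d" "\<And>m. g m \<noteq> 0 \<Longrightarrow> mono_degree m \<le> e"
      by (auto simp: symmetric_functions_def)
    then have "series_add f g m \<noteq> 0 \<Longrightarrow> mono_degree m \<le> max d e" for m
      by (metis series_add_def add_0 le_max_iff_disj)
    then show ?case using add
      by (auto simp: symmetric_functions_def series_add_def)
  next
    case (mult f g)
    then show ?case by (simp add: series_mult_symmetric)
  qed
qed

end

theory Submission
  imports Defs "HOL-Computational_Algebra.Polynomial_FPS"
begin

unbundle fps_syntax

text \<open>
  The shifted Plancherel measures are the marginals of a Markov chain that adds one box at a time.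
  By Schur's product formula for \<open>g\<^sup>\<mu>\<close>, the probability that a row of length \<open>x\<close> grows is the residue
  at \<open>z = x (x + 1)\<close> of \<open>(1 / z) \<Prod>\<^sub>j (z - \<mu>\<^sub>j (\<mu>\<^sub>j - 1)) / (z - \<mu>\<^sub>j (\<mu>\<^sub>j + 1))\<close>. Hence the moments of
  the content \<open>x (x + 1)\<close> of the new box satisfy a Newton recursion whose coefficients are linear
  combinations of odd power sums. Since \<open>(x + 1)\<^sup>r - x\<^sup>r\<close> is a polynomial in \<open>x (x + 1)\<close> for odd \<open>r\<close>,
  the expected increment of a supersymmetric function of degree \<open>d\<close> is a supersymmetric function
  of degree less than \<open>d\<close>. So iterated differences of the expectation in \<open>n\<close> vanish eventually.
\<close>

section \<open>Lagrange interpolation and moments\<close>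

text \<open>Two reflections govern the degrees. For odd \<open>r\<close>,
  \<open>(x + 1) ^ r - x ^ r\<close> is invariant under \<open>x -> - 1 - x\<close>, hence a
  polynomial in \<open>x (x + 1)\<close>. And \<open>j -> - j\<close> exchanges
  \<open>j (j + 1)\<close> with \<open>j (j - 1)\<close>, so differences of their powers are odd in
  \<open>j\<close>. One identity gives both Schur's formula and the Markov property: the weights of
  the partitions one box below \<open>T\<close> add up to \<open>\<Sum>T\<close> times the weight of
  \<open>T\<close>. It is the recursion that counts chains, and it also distributes one of the two
  factors \<open>schur_weight T\<close> of the measure over the predecessors \<open>S\<close>. The
  resulting edge weight \<open>schur_weight S * schur_weight T\<close> is then read from
  \<open>S\<close> as a transition. The powers of 2 match: the exponent grows by one unless a new
  row is opened, and exactly then the transition carries a factor 2.\<close>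

lemma degree_prod_linear_le:
  fixes u v :: "'b \<Rightarrow> 'a::idom"
  assumes "finite J"
  shows "degree (\<Prod>j\<in>J. [:u j, v j:]) \<le> card J"
proof -
  have "degree (\<Prod>j\<in>J. [:u j, v j:]) \<le> (\<Sum>j\<in>J. degree [:u j, v j:])"
    using degree_prod_sum_le[OF assms, of "\<lambda>j. [:u j, v j:]"] by (simp add: o_def)
  also have "\<dots> \<le> (\<Sum>j\<in>J. 1)" by (intro sum_mono) auto
  finally show ?thesis by simp
qed

text \<open>For distinct nodes, the residue at \<open>c i\<close> of the quotient of
  \<open>\<Prod>j\<in>J. z - a j\<close> by \<open>\<Prod>k\<in>I. z - c k\<close>.\<close>

definition lagrange_weight :: "('i \<Rightarrow> 'a::field) \<Rightarrow> 'i set \<Rightarrow> ('j \<Rightarrow> 'a) \<Rightarrow> 'j set \<Rightarrow> 'i \<Rightarrow> 'a" where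
  "lagrange_weight c I a J i = (\<Prod>j\<in>J. c i - a j) / (\<Prod>k\<in>I - {i}. c i - c k)"

lemma lagrange_interpolation:
  fixes c :: "'i \<Rightarrow> 'a::field"
  assumes I: "finite I" and J: "finite J" and inj: "inj_on c I" and card: "card J < card I"
  shows "(\<Prod>j\<in>J. z - a j) = (\<Sum>i\<in>I. lagrange_weight c I a J i * (\<Prod>k\<in>I - {i}. z - c k))"
proof -
  define Q where "Q = (\<Prod>j\<in>J. [:- a j, 1:])"
  define R where "R = (\<Sum>i\<in>I. smult (lagrange_weight c I a J i) (\<Prod>k\<in>I - {i}. [:- c k, 1:]))"
  \<comment> \<open>Both degrees are below the number of nodes, so agreement at the nodes
    suffices.\<close>
  have "Q = R"
  proof (rule poly_eqI_degree)
    show "degree Q < card (c ` I)"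
      using degree_prod_linear_le[OF J, of "\<lambda>j. - a j" "\<lambda>_. 1"] card inj
      by (simp add: Q_def card_image)
    have "degree R \<le> card I - 1"
      unfolding R_def
    proof (rule degree_sum_le[OF I])
      fix i assume "i \<in> I"
      then show "degree (smult (lagrange_weight c I a J i) (\<Prod>k\<in>I - {i}. [:- c k, 1:])) \<le> card I - 1"
        using degree_prod_linear_le[of "I - {i}" "\<lambda>j. - c j" "\<lambda>_. 1"] I
        by (simp add: le_trans[OF degree_smult_le])
    qed
    then show "degree R < card (c ` I)" using card inj by (simp add: card_image)
    fix x assume "x \<in> c ` I"
    then obtain i where i: "i \<in> I" "x = c i" by auto
    have nz: "(\<Prod>k\<in>I - {i}. c i - c k) \<noteq> 0"
      using I i inj by (auto simp: inj_on_def)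
    have "poly R x = (\<Sum>l\<in>I. if l = i then (\<Prod>j\<in>J. c i - a j) else 0)"
      unfolding R_def poly_sum poly_smult poly_prod i(2)
    proof (rule sum.cong[OF refl])
      fix l assume "l \<in> I"
      show "lagrange_weight c I a J l * (\<Prod>k\<in>I - {l}. poly [:- c k, 1:] (c i)) =
        (if l = i then (\<Prod>j\<in>J. c i - a j) else 0)"
      proof (cases "l = i")
        case True then show ?thesis using nz by (simp add: lagrange_weight_def)
      next
        case False
        have "(\<Prod>k\<in>I - {l}. poly [:- c k, 1:] (c i)) = 0"
          using I i False by (intro prod_zero) auto
        then show ?thesis using False by simp
      qed
    qed
    also have "\<dots> = poly Q x" using I i by (simp add: Q_def poly_prod)
    finally show "poly Q x = poly R x" by simp
  qed
  then have "poly Q z = poly R z" by simp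
  then show ?thesis by (simp add: Q_def R_def poly_prod poly_sum)
qed

lemma prod_reverse_linear:
  fixes b :: "'k \<Rightarrow> 'a::field"
  assumes "x \<noteq> 0"
  shows "x ^ card K * (\<Prod>k\<in>K. 1 / x - b k) = (\<Prod>k\<in>K. 1 - x * b k)"
proof -
  have "(\<Prod>k\<in>K. 1 - x * b k) = (\<Prod>k\<in>K. x * (1 / x - b k))"
    using assms by (simp add: right_diff_distrib)
  then show ?thesis by (simp add: prod.distrib)
qed

text \<open>Substituting \<open>z = 1 / x\<close> and multiplying by \<open>x ^ card J\<close>
  reverses every product, because all of them have \<open>card J = card I - 1\<close> factors.
  Equality at all \<open>x \<noteq> 0\<close> gives equality of polynomials since the field is
  infinite.\<close>

lemma lagrange_interpolation_reversed:
  fixes c :: "'i \<Rightarrow> 'a::field_char_0"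
  assumes I: "finite I" and J: "finite J" and inj: "inj_on c I" and card: "card I = Suc (card J)"
  shows "(\<Prod>j\<in>J. [:1, - a j:]) =
    (\<Sum>i\<in>I. smult (lagrange_weight c I a J i) (\<Prod>k\<in>I - {i}. [:1, - c k:]))"
    (is "?Q = ?R")
proof -
  have "poly ?Q x = poly ?R x" if x: "x \<noteq> 0" for x
  proof -
    have scale': "x ^ card J * (\<Prod>k\<in>I - {i}. 1 / x - c k) = (\<Prod>k\<in>I - {i}. 1 - x * c k)" if "i \<in> I" for i
      using prod_reverse_linear[OF x, of "I - {i}" c] that I card by simp
    have "(\<Prod>j\<in>J. 1 - x * a j) =
        x ^ card J * (\<Sum>i\<in>I. lagrange_weight c I a J i * (\<Prod>k\<in>I - {i}. 1 / x - c k))"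
      using lagrange_interpolation[OF I J inj, of "1 / x" a] card prod_reverse_linear[OF x, of J a] by simp
    also have "\<dots> = (\<Sum>i\<in>I. lagrange_weight c I a J i * (\<Prod>k\<in>I - {i}. 1 - x * c k))"
      using scale' by (auto simp: sum_distrib_left mult.left_commute[of "x ^ card J"] intro!: sum.cong)
    finally show ?thesis by (simp add: poly_prod poly_sum)
  qed
  then have "UNIV - {0} \<subseteq> {x. poly (?Q - ?R) x = 0}" by auto
  moreover have "infinite (UNIV - {0 :: 'a})" by (simp add: infinite_UNIV_char_0)
  ultimately have "infinite {x. poly (?Q - ?R) x = 0}" using finite_subset by blast
  then show ?thesis using poly_roots_finite[of "?Q - ?R"] by fastforce
qed

section \<open>Moments of the weights and Newton's recursion\<close>

definition power_diff :: "('i \<Rightarrow> 'a::field) \<Rightarrow> 'i set \<Rightarrow> ('j \<Rightarrow> 'a) \<Rightarrow> 'j set \<Rightarrow> nat \<Rightarrow> 'a" where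
  "power_diff c I a J m = (\<Sum>i\<in>I. c i ^ m) - (\<Sum>j\<in>J. a j ^ m)"

text \<open>For distinct nodes and \<open>card I = Suc (card J)\<close> this is the complete
  homogeneous symmetric function of degree \<open>k\<close> in the difference of the alphabets
  \<open>c\<close> and \<open>a\<close>; \<open>power_diff\<close> is the power sum of that
  difference.\<close>

definition moment :: "('i \<Rightarrow> 'a::field) \<Rightarrow> 'i set \<Rightarrow> ('j \<Rightarrow> 'a) \<Rightarrow> 'j set \<Rightarrow> nat \<Rightarrow> 'a" where
  "moment c I a J k = (\<Sum>i\<in>I. lagrange_weight c I a J i * c i ^ k)"

lemma geometric_fps: "(1 - fps_const b * fps_X) * Abs_fps (\<lambda>n. b ^ n) = (1 :: 'a::field fps)"
proof (rule fps_ext)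
  fix n
  show "((1 - fps_const b * fps_X) * Abs_fps (\<lambda>n. b ^ n)) $ n = (1 :: 'a fps) $ n"
    by (cases n) (auto simp: left_diff_distrib mult.assoc)
qed

lemma fps_log_deriv_prod:
  fixes b :: "'i \<Rightarrow> 'a::field_char_0"
  assumes "finite K"
  shows "fps_X * fps_deriv (\<Prod>k\<in>K. 1 - fps_const (b k) * fps_X) =
    - (\<Prod>k\<in>K. 1 - fps_const (b k) * fps_X) * (\<Sum>k\<in>K. fps_const (b k) * fps_X * Abs_fps (\<lambda>n. b k ^ n))"
  using assms
proof induction
  case empty then show ?case by simp
next
  case (insert i K)
  let ?P = "\<Prod>k\<in>K. 1 - fps_const (b k) * fps_X"
  let ?S = "\<Sum>k\<in>K. fps_const (b k) * fps_X * Abs_fps (\<lambda>n. b k ^ n)"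
  let ?l = "1 - fps_const (b i) * fps_X" and ?g = "Abs_fps (\<lambda>n. b i ^ n)"
  have "fps_X * fps_deriv (?l * ?P) = ?l * (fps_X * fps_deriv ?P) - fps_const (b i) * fps_X * ?P"
    by (simp add: algebra_simps)
  also have "\<dots> = - (?l * ?P) * ?S - (?l * ?g) * (fps_const (b i) * fps_X * ?P)"
    unfolding insert.IH geometric_fps by simp
  also have "\<dots> = - (?l * ?P) * (fps_const (b i) * fps_X * ?g + ?S)"
    by (simp add: algebra_simps)
  finally show ?case using insert by simp
qed

lemma fps_prod_linear_nth_0: "(\<Prod>k\<in>K. 1 - fps_const (b k) * fps_X) $ 0 = (1 :: 'a::field)"
  by (induction K rule: infinite_finite_induct) simp_all

text \<open>Partial fractions, in reversed form, identify the generating function of the moments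
  with \<open>N / D\<close>, the product of the \<open>1 - a j X\<close> over the product of the
  \<open>1 - c i X\<close>. Its logarithmic derivative, cleared of denominators, is the
  recursion.\<close>

lemma
  fixes c :: "'i \<Rightarrow> 'a::field_char_0" and a :: "'j \<Rightarrow> 'a"
  assumes I: "finite I" and J: "finite J" and inj: "inj_on c I" and card: "card I = Suc (card J)"
  shows moment_0: "moment c I a J 0 = 1"
    and moment_rec: "of_nat k * moment c I a J k =
      (\<Sum>m=1..k. power_diff c I a J m * moment c I a J (k - m))"
proof -
  let ?w = "lagrange_weight c I a J"
  define lin where "lin b = 1 - fps_const b * (fps_X :: 'a fps)" for b
  have lin: "fps_of_poly [:1, - b:] = lin b" for b
    by (simp add: lin_def fps_of_poly_pCons mult.commute)
  define H where "H = (\<Sum>i\<in>I. fps_const (?w i) * Abs_fps (\<lambda>n. c i ^ n))"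
  have H_nth: "H $ k = moment c I a J k" for k
    by (simp add: H_def moment_def fps_sum_nth)
  define D where "D = (\<Prod>i\<in>I. lin (c i))"
  define N where "N = (\<Prod>j\<in>J. lin (a j))"
  have "H * D = (\<Sum>i\<in>I. fps_const (?w i) * (\<Prod>k\<in>I - {i}. lin (c k)))"
    unfolding H_def sum_distrib_right
  proof (rule sum.cong[OF refl])
    fix i assume "i \<in> I"
    then have "D = lin (c i) * (\<Prod>k\<in>I - {i}. lin (c k))"
      unfolding D_def using I by (simp add: prod.remove)
    then show "fps_const (?w i) * Abs_fps (\<lambda>n. c i ^ n) * D = fps_const (?w i) * (\<Prod>k\<in>I - {i}. lin (c k))"
      using geometric_fps[of "c i"] by (simp add: lin_def mult_ac)
  qed
  also have "\<dots> = N"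
    using arg_cong[OF lagrange_interpolation_reversed[OF I J inj card, of a], of fps_of_poly]
    by (simp add: fps_of_poly_prod fps_of_poly_sum fps_of_poly_smult lin N_def)
  finally have HD: "H * D = N" .
  have D0: "D $ 0 = 1" and N0: "N $ 0 = 1"
    by (simp_all add: D_def N_def lin_def fps_prod_linear_nth_0)
  show "moment c I a J 0 = 1"
    using arg_cong[OF HD, of "\<lambda>f. f $ 0"] D0 N0 by (simp add: H_nth)
  define SC where "SC = (\<Sum>i\<in>I. fps_const (c i) * fps_X * Abs_fps (\<lambda>n. c i ^ n))"
  define SA where "SA = (\<Sum>j\<in>J. fps_const (a j) * fps_X * Abs_fps (\<lambda>n. a j ^ n))"
  have "fps_X * fps_deriv D = - D * SC"
    using fps_log_deriv_prod[OF I, of c] by (simp add: D_def SC_def lin_def)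
  then have "fps_X * fps_deriv (H * D) = fps_X * fps_deriv H * D + H * (- D * SC)"
    by (simp only: fps_deriv_mult distrib_left mult.left_commute[of fps_X H] mult.assoc add.commute)
  moreover have "fps_X * fps_deriv N = - N * SA"
    using fps_log_deriv_prod[OF J, of a] by (simp add: N_def SA_def lin_def)
  ultimately have "fps_X * fps_deriv H * D + H * (- D * SC) = - (H * D) * SA"
    unfolding HD by simp
  then have "(fps_X * fps_deriv H) * D = (SC - SA) * H * D"
    by (simp add: algebra_simps)
  moreover have "D \<noteq> 0" using D0 by auto
  ultimately have eq: "fps_X * fps_deriv H = (SC - SA) * H" by simp
  have S_nth: "(SC - SA) $ m = (if m = 0 then 0 else power_diff c I a J m)" for m
    by (cases m) (simp_all add: SC_def SA_def power_diff_def fps_sum_nth mult.assoc sum_subtractf)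
  have "of_nat k * moment c I a J k = (fps_X * fps_deriv H) $ k"
    by (cases k) (simp_all add: H_nth)
  also have "\<dots> = (\<Sum>m=0..k. (if m = 0 then 0 else power_diff c I a J m) * moment c I a J (k - m))"
    unfolding eq fps_mult_nth by (simp add: S_nth H_nth del: fps_sub_nth)
  also have "\<dots> = (\<Sum>m=1..k. power_diff c I a J m * moment c I a J (k - m))"
    by (rule sum.mono_neutral_cong_right) auto
  finally show "of_nat k * moment c I a J k = \<dots>" .
qed

text \<open>With as many zeros as nodes, an auxiliary node \<open>w\<close> restores the one surplus
  node that the moment formulas require. The weights \<open>c i - w\<close> remove its contribution
  and leave moment 1 minus \<open>w\<close> times moment 0.\<close>

lemma sum_prod_diff_quotient:
  fixes a b :: "'i \<Rightarrow> 'a::field_char_0"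
  assumes I: "finite I" and inj: "inj_on a I"
  shows "(\<Sum>i\<in>I. (\<Prod>j\<in>I. a i - b j) / (\<Prod>k\<in>I - {i}. a i - a k)) = (\<Sum>i\<in>I. a i - b i)"
proof -
  obtain w where w: "w \<notin> a ` I"
    using I ex_new_if_finite[OF infinite_UNIV_char_0, of "a ` I"] by blast
  define I' where "I' = insert None (Some ` I)"
  define c where "c = case_option w a"
  have I': "finite I'" "card I' = Suc (card I)" "inj_on c I'"
    using I inj w by (auto simp: I'_def c_def card_image inj_on_def)
  have split: "(\<Sum>i\<in>I'. h i) = h None + (\<Sum>i\<in>I. h (Some i))" for h :: "'i option \<Rightarrow> 'a"
    using I by (simp add: I'_def sum.reindex)
  have "(\<Sum>i\<in>I. (\<Prod>j\<in>I. a i - b j) / (\<Prod>k\<in>I - {i}. a i - a k)) =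
      (\<Sum>i\<in>I'. lagrange_weight c I' b I i * (c i - w))"
  proof -
    have "(\<Prod>j\<in>I. a i - b j) / (\<Prod>k\<in>I - {i}. a i - a k) = lagrange_weight c I' b I (Some i) * (a i - w)"
      if i: "i \<in> I" for i
    proof -
      have "I' - {Some i} = insert None (Some ` (I - {i}))" by (auto simp: I'_def)
      then have "(\<Prod>k\<in>I' - {Some i}. c (Some i) - c k) = (a i - w) * (\<Prod>k\<in>I - {i}. a i - a k)"
        using I by (simp add: prod.reindex c_def)
      moreover have "a i - w \<noteq> 0" using w i by auto
      ultimately show ?thesis by (simp add: lagrange_weight_def c_def)
    qed
    then show ?thesis unfolding split by (simp add: c_def)
  qed
  also have "\<dots> = moment c I' b I 1 - w * moment c I' b I 0"
    by (simp add: moment_def algebra_simps sum_subtractf sum_distrib_left)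
  also have "\<dots> = power_diff c I' b I 1 - w"
    using moment_0[OF I'(1) I I'(3,2), of b] moment_rec[OF I'(1) I I'(3,2), of 1 b] by simp
  also have "\<dots> = (\<Sum>i\<in>I. a i - b i)"
    unfolding power_diff_def split by (simp add: c_def sum_subtractf)
  finally show ?thesis .
qed

section \<open>The transition probabilities\<close>

definition box_content :: "nat \<Rightarrow> rat" where
  "box_content x = of_nat x * (of_nat x + 1)"

definition lower_content :: "nat \<Rightarrow> rat" where
  "lower_content x = of_nat x * (of_nat x - 1)"

lemma lower_content_Suc [simp]: "lower_content (Suc x) = box_content x"
  by (simp add: lower_content_def box_content_def algebra_simps)

lemma box_content_Suc: "box_content x = of_nat x * of_nat (Suc x)"
  by (simp add: box_content_def)

lemma box_content_0 [simp]: "box_content 0 = 0"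
  by (simp add: box_content_def)

lemma box_content_diff: "box_content x - box_content y = (of_nat x - of_nat y) * (of_nat x + of_nat y + 1)"
  by (simp add: box_content_def algebra_simps)

lemma box_content_eq_iff [simp]: "box_content x = box_content y \<longleftrightarrow> x = y"
proof -
  have "of_nat x + of_nat y + 1 \<noteq> (0 :: rat)"
    by (metis of_nat_1 of_nat_add of_nat_eq_0_iff add_is_0 one_neq_zero)
  then show ?thesis using box_content_diff[of x y] by auto
qed

section \<open>Schur's product and its change when a row grows\<close>

definition pair_factor :: "nat \<Rightarrow> nat \<Rightarrow> rat" where
  "pair_factor i j = (of_nat (max i j) - of_nat (min i j)) / (of_nat i + of_nat j)"

lemma pair_factor_commute: "pair_factor i j = pair_factor j i"
  by (simp add: pair_factor_def max.commute min.commute add.commute)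

text \<open>
  Schur's product formula for \<open>g\<^sup>\<mu> / |\<mu>|!\<close>, where \<open>S\<close> is the set of parts of \<open>\<mu>\<close>. Adding the junk
  part 0 does not change the value, so a new row can be treated as a row of length 0 that grows.
\<close>

definition schur_weight :: "nat set \<Rightarrow> rat" where
  "schur_weight S = (\<Prod>i\<in>S. 1 / fact i) * (\<Prod>(i, j)\<in>{(i, j). i \<in> S \<and> j \<in> S \<and> i < j}. pair_factor i j)"

lemma schur_weight_empty [simp]: "schur_weight {} = 1"
  by (simp add: schur_weight_def)

lemma schur_weight_insert:
  assumes S: "finite S" and y: "y \<notin> S"
  shows "schur_weight (insert y S) = schur_weight S * (1 / fact y) * (\<Prod>j\<in>S. pair_factor y j)"
proof -
  let ?P = "\<lambda>S. {(i, j). i \<in> S \<and> j \<in> S \<and> i < (j :: nat)}"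
  let ?f = "\<lambda>j. (min y j, max y j)"
  have fin: "finite (?P S)" by (rule finite_subset[of _ "S \<times> S"]) (use S in auto)
  have eq: "?P (insert y S) = ?P S \<union> ?f ` S"
    using y by (auto simp: image_iff min_def max_def) (metis linorder_neqE_nat less_imp_le_nat leD)+
  have inj: "inj_on ?f S"
    by (auto simp: inj_on_def min_def max_def split: if_splits)
  have "?P S \<inter> ?f ` S = {}" using y by (auto simp: min_def max_def split: if_splits)
  then have "(\<Prod>(i, j)\<in>?P (insert y S). pair_factor i j) =
      (\<Prod>(i, j)\<in>?P S. pair_factor i j) * (\<Prod>j\<in>S. pair_factor (min y j) (max y j))"
    unfolding eq using S fin inj by (simp add: prod.union_disjoint prod.reindex)
  moreover have "pair_factor (min y j) (max y j) = pair_factor y j" for j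
    by (auto simp: min_def max_def pair_factor_commute)
  ultimately show ?thesis using S y by (simp add: schur_weight_def mult_ac)
qed

lemma schur_weight_insert_0:
  assumes "finite S" and "0 \<notin> S"
  shows "schur_weight (insert 0 S) = schur_weight S"
proof -
  have "pair_factor 0 j = 1" if "j \<in> S" for j
    using assms that by (cases j) (auto simp: pair_factor_def)
  then show ?thesis using assms by (simp add: schur_weight_insert)
qed

text \<open>Origin of the two contents: when row \<open>x\<close> grows, its factor with
  \<open>j\<close> changes by \<open>(x + 1 - j) (x + j) / ((x - j) (x + j + 1))\<close>, and these
  products are the distances of \<open>box_content x\<close> from \<open>lower_content j\<close> and
  from \<open>box_content j\<close>. As \<open>j\<close> is neither \<open>x\<close> nor
  \<open>Suc x\<close>, the order of the parts is kept and the signs agree.\<close>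

lemma pair_factor_Suc:
  assumes "j \<noteq> x" "j \<noteq> Suc x" "j \<noteq> 0"
  shows "pair_factor (Suc x) j * (box_content x - box_content j) = pair_factor x j * (box_content x - lower_content j)"
proof -
  define X J :: rat where "X = of_nat x" and "J = of_nat j"
  have X: "X \<ge> 0" "J > 0" using assms by (auto simp: X_def J_def)
  have "box_content x - box_content j = (X - J) * (X + J + 1)" by (simp add: box_content_diff X_def J_def)
  moreover have "box_content x - lower_content j = (X + 1 - J) * (X + J)"
    by (simp add: box_content_def lower_content_def X_def J_def algebra_simps)
  moreover consider "j < x" | "Suc x < j" using assms by linarith
  then have "pair_factor (Suc x) j * (X + J + 1) * (X - J) = pair_factor x j * (X + J) * (X + 1 - J)"
  proof cases
    case 1
    then have "pair_factor (Suc x) j * (X + J + 1) = X + 1 - J" "pair_factor x j * (X + J) = X - J"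
      using X by (auto simp: pair_factor_def X_def J_def max_def min_def add_ac)
    then show ?thesis by simp
  next
    case 2
    then have "pair_factor (Suc x) j * (X + J + 1) = J - X - 1" "pair_factor x j * (X + J) = J - X"
      using X by (auto simp: pair_factor_def X_def J_def max_def min_def add_ac)
    moreover have "X - J = - (J - X)" "X + 1 - J = - (J - X - 1)" by simp_all
    ultimately show ?thesis by (simp only: mult.commute mult_minus_right mult_minus_left)
  qed
  ultimately show ?thesis by (simp add: mult_ac)
qed

lemma schur_weight_move:
  assumes S: "finite S" "0 \<notin> S" and x: "x \<notin> S" "Suc x \<notin> S"
  shows "schur_weight (insert (Suc x) S) * of_nat (Suc x) * (\<Prod>j\<in>S. box_content x - box_content j) =
    schur_weight (insert x S) * (\<Prod>j\<in>S. box_content x - lower_content j)"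
proof -
  have "(\<Prod>j\<in>S. pair_factor (Suc x) j) * (\<Prod>j\<in>S. box_content x - box_content j) =
      (\<Prod>j\<in>S. pair_factor x j) * (\<Prod>j\<in>S. box_content x - lower_content j)"
    unfolding prod.distrib[symmetric] using assms by (intro prod.cong refl pair_factor_Suc) (auto intro: gr0I)
  moreover have "of_nat (Suc x) * (1 / fact (Suc x)) = (1 / fact x :: rat)"
    by (simp del: of_nat_Suc)
  ultimately have "(of_nat (Suc x) * (1 / fact (Suc x))) *
     ((\<Prod>j\<in>S. pair_factor (Suc x) j) * (\<Prod>j\<in>S. box_content x - box_content j)) =
     1 / fact x * ((\<Prod>j\<in>S. pair_factor x j) * (\<Prod>j\<in>S. box_content x - lower_content j))"
    by (simp only:)
  then show ?thesis
    by (simp only: schur_weight_insert[OF S(1) x(1)] schur_weight_insert[OF S(1) x(2)] mult_ac)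
qed

text \<open>Strict partitions are identified with their sets of parts from here on.\<close>

definition strict_sets :: "nat \<Rightarrow> nat set set" where
  "strict_sets n = {S. finite S \<and> 0 \<notin> S \<and> \<Sum>S = n}"

definition add_box :: "nat set \<Rightarrow> nat \<Rightarrow> nat set" where
  "add_box S x = insert (Suc x) (S - {x})"

definition remove_box :: "nat set \<Rightarrow> nat \<Rightarrow> nat set" where
  "remove_box T x = insert x (T - {Suc x}) - {0}"

text \<open>
  The probability that the row of length \<open>x\<close> is the one that grows in the Markov chain whose
  marginals are the shifted Plancherel measures. It vanishes if the row is blocked.
\<close>

definition transition :: "nat set \<Rightarrow> nat \<Rightarrow> rat" where
  "transition S x = lagrange_weight box_content (insert 0 S) lower_content S x"

text \<open>Since \<open>lower_content (Suc x) = box_content x\<close>, a blocking part puts a zero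
  of the numerator on the node. Sums over rows may thus include the blocked ones.\<close>

lemma transition_eq_0:
  assumes "finite S" "Suc x \<in> S"
  shows "transition S x = 0"
  using assms unfolding transition_def lagrange_weight_def by (auto intro!: bexI[of _ "Suc x"])

lemma schur_weight_add_box:
  assumes S: "finite S" "0 \<notin> S" and x: "x \<in> insert 0 S" "Suc x \<notin> S"
  shows "schur_weight S * transition S x = schur_weight (add_box S x) * (if x = 0 then 1 else 2)"
proof -
  let ?R = "S - {x}"
  have R: "finite ?R" "0 \<notin> ?R" "x \<notin> ?R" "Suc x \<notin> ?R" using S x by auto
  have D: "(\<Prod>j\<in>?R. box_content x - box_content j) \<noteq> 0" using R by simp
  have ins: "schur_weight (insert x ?R) = schur_weight S"
    using S x schur_weight_insert_0[OF S] by (cases "x = 0") (auto simp: insert_absorb)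
  have move: "schur_weight S * (\<Prod>j\<in>?R. box_content x - lower_content j) =
     schur_weight (add_box S x) * of_nat (Suc x) * (\<Prod>j\<in>?R. box_content x - box_content j)"
    using schur_weight_move[OF R] unfolding ins add_box_def ..
  show ?thesis
  proof (cases "x = 0")
    case True
    with S have "?R = S" "insert 0 S - {x} = S" by auto
    with True have "transition S x = (\<Prod>j\<in>?R. box_content x - lower_content j) / (\<Prod>j\<in>?R. box_content x - box_content j)"
      by (simp add: transition_def lagrange_weight_def)
    then have "schur_weight S * transition S x =
        schur_weight S * (\<Prod>j\<in>?R. box_content x - lower_content j) / (\<Prod>j\<in>?R. box_content x - box_content j)"
      by simp
    also have "\<dots> = schur_weight (add_box S x)"
      unfolding move using D True by simp
    finally show ?thesis using True by simp
  next
    case False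
    with x have "x \<in> S" by auto
    \<comment> \<open>The node 0 contributes \<open>x (x + 1)\<close> to the denominator and the
      part \<open>x\<close> contributes \<open>2 x\<close> to the numerator. Together they turn the
      factor \<open>Suc x\<close> of \<open>schur_weight_move\<close> into 2.\<close>
    have "insert 0 S - {x} = insert 0 ?R" using False by auto
    then have "(\<Prod>k\<in>insert 0 S - {x}. box_content x - box_content k) = box_content x * (\<Prod>j\<in>?R. box_content x - box_content j)"
      using R by simp
    moreover have "(\<Prod>j\<in>S. box_content x - lower_content j) = 2 * of_nat x * (\<Prod>j\<in>?R. box_content x - lower_content j)"
      using S \<open>x \<in> S\<close> by (simp add: prod.remove box_content_def lower_content_def algebra_simps)
    ultimately have "transition S x = 2 * of_nat x * (\<Prod>j\<in>?R. box_content x - lower_content j) / (box_content x * (\<Prod>j\<in>?R. box_content x - box_content j))"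
      by (simp add: transition_def lagrange_weight_def)
    then have "schur_weight S * transition S x = 2 * of_nat x *
       (schur_weight S * (\<Prod>j\<in>?R. box_content x - lower_content j)) / (box_content x * (\<Prod>j\<in>?R. box_content x - box_content j))"
      by simp
    also have "\<dots> = 2 * of_nat x * (schur_weight (add_box S x) * of_nat (Suc x) * (\<Prod>j\<in>?R. box_content x - box_content j)) / (box_content x * (\<Prod>j\<in>?R. box_content x - box_content j))"
      by (simp only: move)
    also have "\<dots> = schur_weight (add_box S x) * 2"
      using D False by (simp add: box_content_Suc del: of_nat_Suc)
    finally show ?thesis using False by simp
  qed
qed

text \<open>
  Divided by \<open>schur_weight T\<close>, the summands are residues of the rational function
  \<open>\<Prod>\<^sub>j (z - box_content j) / (z - lower_content j)\<close>, up to the factor \<open>- 2\<close>;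
  blocked rows contribute residue 0.
\<close>

lemma sum_schur_weight_remove_box:
  assumes T: "finite T" "0 \<notin> T"
  shows "(\<Sum>x\<in>{x. Suc x \<in> T \<and> x \<notin> T}. schur_weight (remove_box T x)) = of_nat (\<Sum>T) * schur_weight T"
proof -
  let ?q = "\<lambda>y. (\<Prod>j\<in>T. lower_content y - box_content j) / (\<Prod>k\<in>T - {y}. lower_content y - lower_content k)"
  \<comment> \<open>\<open>lower_content\<close> vanishes at both 0 and 1, so injectivity relies on
    \<open>0 \<notin> T\<close>.\<close>
  have inj: "inj_on lower_content T"
  proof (rule inj_onI)
    fix u v assume "u \<in> T" "v \<in> T" and eq: "lower_content u = lower_content v"
    with T obtain u' v' where "u = Suc u'" "v = Suc v'" by (metis not0_implies_Suc)
    with eq show "u = v" by simp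
  qed
  have "(\<Sum>y\<in>T. ?q y) = (\<Sum>y\<in>T. lower_content y - box_content y)"
    by (rule sum_prod_diff_quotient[OF T(1) inj])
  also have "\<dots> = (\<Sum>y\<in>T. - 2 * of_nat y)"
    by (simp add: lower_content_def box_content_def algebra_simps)
  also have "\<dots> = - 2 * of_nat (\<Sum>T)"
    by (simp only: of_nat_sum sum_distrib_left)
  finally have q: "(\<Sum>y\<in>T. ?q y) = - 2 * of_nat (\<Sum>T)" .
  have "(\<Sum>y\<in>T. ?q y) = (\<Sum>y\<in>Suc ` {x. Suc x \<in> T \<and> x \<notin> T}. ?q y)"
  proof (rule sum.mono_neutral_right[OF T(1)])
    show "\<forall>y\<in>T - Suc ` {x. Suc x \<in> T \<and> x \<notin> T}. ?q y = 0"
    proof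
      fix y assume y: "y \<in> T - Suc ` {x. Suc x \<in> T \<and> x \<notin> T}"
      with T obtain x where x: "y = Suc x" by (metis Diff_iff not0_implies_Suc)
      with y have "x \<in> T" by auto
      then show "?q y = 0" using T x by (auto intro!: bexI[of _ x])
    qed
  qed auto
  also have "\<dots> = (\<Sum>x\<in>{x. Suc x \<in> T \<and> x \<notin> T}. ?q (Suc x))"
    by (simp add: sum.reindex)
  also have "schur_weight T * \<dots> = - 2 * (\<Sum>x\<in>{x. Suc x \<in> T \<and> x \<notin> T}. schur_weight (remove_box T x))"
    unfolding sum_distrib_left
  proof (rule sum.cong[OF refl])
    fix x assume "x \<in> {x. Suc x \<in> T \<and> x \<notin> T}"
    then have x: "Suc x \<in> T" "x \<notin> T" by auto
    let ?R = "T - {Suc x}"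
    have R: "finite ?R" "0 \<notin> ?R" "x \<notin> ?R" "Suc x \<notin> ?R" using T x by auto
    have ne: "lower_content j \<noteq> box_content x" if "j \<in> ?R" for j
      using inj that x(1) inj_onD[OF inj, of j "Suc x"] by auto
    have D: "(\<Prod>j\<in>?R. box_content x - lower_content j) \<noteq> 0"
      unfolding prod_zero_iff[OF R(1)] using ne by (metis right_minus_eq)
    have "schur_weight (insert x ?R) = schur_weight (remove_box T x)"
      using schur_weight_insert_0[of ?R] R by (cases "x = 0") (auto simp: remove_box_def insert_absorb)
    moreover have "insert (Suc x) ?R = T" using x by auto
    ultimately have move: "schur_weight T * of_nat (Suc x) * (\<Prod>j\<in>?R. box_content x - box_content j) =
        schur_weight (remove_box T x) * (\<Prod>j\<in>?R. box_content x - lower_content j)"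
      using schur_weight_move[OF R] by simp
    \<comment> \<open>The part \<open>Suc x\<close> itself contributes the factor that supplies both
      the \<open>- 2\<close> and the \<open>Suc x\<close> of
      \<open>schur_weight_move\<close>.\<close>
    have "?q (Suc x) = (box_content x - box_content (Suc x)) * (\<Prod>j\<in>?R. box_content x - box_content j) / (\<Prod>j\<in>?R. box_content x - lower_content j)"
      using T x by (simp add: prod.remove)
    also have "box_content x - box_content (Suc x) = - 2 * of_nat (Suc x)"
      by (simp add: box_content_def algebra_simps)
    finally have "schur_weight T * ?q (Suc x) = - 2 * (schur_weight T * of_nat (Suc x) *
        (\<Prod>j\<in>?R. box_content x - box_content j)) / (\<Prod>j\<in>?R. box_content x - lower_content j)"
      by (simp del: of_nat_Suc)
    then show "schur_weight T * ?q (Suc x) = - 2 * schur_weight (remove_box T x)"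
      unfolding move using D by simp
  qed
  finally show ?thesis using q by (simp add: mult.commute)
qed

section \<open>A filtration on supersymmetric functions\<close>

definition set_power_sum :: "nat \<Rightarrow> nat set \<Rightarrow> rat" where
  "set_power_sum r S = (\<Sum>j\<in>S. of_nat j ^ r)"

text \<open>On strict partitions, a polynomial in odd power sums of weighted degree at most
  \<open>d\<close>, the \<open>r\<close>-th power sum having weight \<open>r\<close>.
  \<open>cong\<close> leaves the values at all other sets free.\<close>

inductive filtered :: "nat \<Rightarrow> (nat set \<Rightarrow> rat) \<Rightarrow> bool" where
  const: "filtered d (\<lambda>_. c)"
| psum: "odd r \<Longrightarrow> filtered r (set_power_sum r)"
| add: "filtered d f \<Longrightarrow> filtered d g \<Longrightarrow> filtered d (\<lambda>S. f S + g S)"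
| mult: "filtered d f \<Longrightarrow> filtered e g \<Longrightarrow> filtered (d + e) (\<lambda>S. f S * g S)"
| cong: "filtered d f \<Longrightarrow> (\<And>S. finite S \<Longrightarrow> 0 \<notin> S \<Longrightarrow> f S = g S) \<Longrightarrow> filtered d g"
| mono: "filtered d f \<Longrightarrow> d \<le> e \<Longrightarrow> filtered e f"

text \<open>
  The changes of filtered functions when the row of length \<open>x\<close> grows; \<open>box_content x\<close> counts as
  degree 2, and the bound \<open>d\<close> is strict.
\<close>

inductive increment :: "nat \<Rightarrow> (nat set \<Rightarrow> nat \<Rightarrow> rat) \<Rightarrow> bool" where
  zero: "increment d (\<lambda>_ _. 0)"
| base: "filtered e g \<Longrightarrow> e + 2 * k < d \<Longrightarrow> increment d (\<lambda>S x. g S * box_content x ^ k)"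
| add: "increment d A \<Longrightarrow> increment d B \<Longrightarrow> increment d (\<lambda>S x. A S x + B S x)"

lemma filtered_sum:
  assumes "\<And>i. i \<in> I \<Longrightarrow> filtered d (f i)"
  shows "filtered d (\<lambda>S. \<Sum>i\<in>I. f i S)"
  using assms
  by (induction I rule: infinite_finite_induct) (auto intro: filtered.const filtered.add)

lemma filtered_scale: "filtered d f \<Longrightarrow> filtered d (\<lambda>S. c * f S)"
  using filtered.mult[OF filtered.const[of 0 c]] by simp

lemma increment_mono: "increment d A \<Longrightarrow> d \<le> e \<Longrightarrow> increment e A"
  by (induction rule: increment.induct) (auto intro: increment.intros)

lemma increment_mult_filtered:
  "increment d A \<Longrightarrow> filtered e f \<Longrightarrow> increment (d + e) (\<lambda>S x. A S x * f S)"
proof (induction rule: increment.induct)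
  case (base e' g k d)
  have "increment (d + e) (\<lambda>S x. (g S * f S) * box_content x ^ k)"
    using base by (intro increment.base[OF filtered.mult]) auto
  then show ?case by (simp add: mult_ac)
next
  case (add d A B)
  then show ?case using increment.add[of "d + e"] by (simp add: distrib_right)
qed (simp add: increment.zero)

lemma increment_mult_content:
  "increment d A \<Longrightarrow> increment (d + 2 * k) (\<lambda>S x. A S x * box_content x ^ k)"
proof (induction rule: increment.induct)
  case (base e' g l d)
  have "increment (d + 2 * k) (\<lambda>S x. g S * box_content x ^ (l + k))"
    using base by (intro increment.base) auto
  then show ?case by (simp add: mult_ac power_add)
next
  case (add d A B)
  then show ?case using increment.add[of "d + 2 * k"] by (simp add: distrib_right)
qed (simp add: increment.zero)

lemma increment_mult:
  assumes "increment d A" and "increment e B"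
  shows "increment (d + e) (\<lambda>S x. A S x * B S x)"
  using assms(2,1)
proof (induction rule: increment.induct)
  case (base e' g k e)
  have "increment (d + e' + 2 * k) (\<lambda>S x. A S x * g S * box_content x ^ k)"
    by (intro increment_mult_content increment_mult_filtered base)
  then show ?case using base by (auto simp: mult_ac intro: increment_mono)
next
  case (add e A B)
  then show ?case using increment.add[of "d + e"] by (simp add: distrib_left)
qed (simp add: increment.zero)

text \<open>The numbers \<open>x + 1\<close> and \<open>- x\<close> have sum 1 and product \<open>- box_content x\<close>.\<close>

lemma increment_power_sum:
  "increment (2 * (r div 2) + 1) (\<lambda>S x. (of_nat x + 1) ^ r + (- of_nat x) ^ r)"
proof (induction r rule: induct_nat_012)
  case 0
  show ?case using increment.base[OF filtered.const, of 0 0 1 2] by simp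
next
  case 1
  show ?case using increment.base[OF filtered.const, of 0 0 1 1] by simp
next
  case (ge2 r)
  have "(\<lambda>S x. (of_nat x + 1) ^ Suc (Suc r) + (- of_nat x) ^ Suc (Suc r)) =
     (\<lambda>(S :: nat set) x. ((of_nat x + 1) ^ Suc r + (- of_nat x) ^ Suc r) +
       ((of_nat x + 1) ^ r + (- of_nat x) ^ r) * box_content x ^ 1)"
    by (intro ext) (simp add: box_content_def algebra_simps)
  moreover have "increment (2 * (Suc (Suc r) div 2) + 1) \<dots>"
    by (rule increment.add[OF increment_mono[OF ge2(2)]
        increment_mono[OF increment_mult_content[OF ge2(1), of 1]]]) auto
  ultimately show ?case by simp
qed

text \<open>Oddness turns \<open>(- x) ^ r\<close> into \<open>- x ^ r\<close> and makes
  \<open>2 * (r div 2) + 1\<close> equal to \<open>r\<close>. As the bound is strict, the increment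
  of a power sum loses a degree.\<close>

lemma increment_odd_power:
  assumes "odd r"
  shows "increment r (\<lambda>S x. of_nat (Suc x) ^ r - of_nat x ^ r)"
  using increment_power_sum[of r] assms by (simp add: power_minus_odd add.commute)

lemma filtered_add_box:
  assumes "filtered d f"
  shows "\<exists>A. increment d A \<and> (\<forall>S x. finite S \<longrightarrow> 0 \<notin> S \<longrightarrow> x \<in> insert 0 S \<longrightarrow> Suc x \<notin> S \<longrightarrow>
    f (add_box S x) = f S + A S x)"
  using assms
proof induction
  case (const d c)
  then show ?case using increment.zero by (intro exI[of _ "\<lambda>_ _. 0"]) auto
next
  case (psum r)
  have "set_power_sum r (add_box S x) = set_power_sum r S + (of_nat (Suc x) ^ r - of_nat x ^ r)"
    if "finite S" "0 \<notin> S" "x \<in> insert 0 S" "Suc x \<notin> S" for S x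
  proof -
    \<comment> \<open>A row of length 0 adds nothing to the power sum, so a newly opened row obeys
      the same formula.\<close>
    have "0 ^ r = (0 :: rat)" using psum by (metis odd_pos zero_power)
    then have "set_power_sum r S = of_nat x ^ r + set_power_sum r (S - {x})"
      using that by (cases "x = 0") (auto simp: set_power_sum_def sum.remove)
    moreover have "set_power_sum r (add_box S x) = of_nat (Suc x) ^ r + set_power_sum r (S - {x})"
      using that by (simp add: set_power_sum_def add_box_def)
    ultimately show ?thesis by simp
  qed
  then show ?case using increment_odd_power[OF psum] by blast
next
  case (add d f g)
  then obtain A B where AB: "increment d A" "increment d B"
    and eq: "\<And>S x. finite S \<Longrightarrow> 0 \<notin> S \<Longrightarrow> x \<in> insert 0 S \<Longrightarrow> Suc x \<notin> S \<Longrightarrow> f (add_box S x) = f S + A S x"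
      "\<And>S x. finite S \<Longrightarrow> 0 \<notin> S \<Longrightarrow> x \<in> insert 0 S \<Longrightarrow> Suc x \<notin> S \<Longrightarrow> g (add_box S x) = g S + B S x"
    by metis
  show ?case
    using increment.add[OF AB] by (intro exI[of _ "\<lambda>S x. A S x + B S x"]) (simp add: eq)
next
  case (mult d f e g)
  then obtain A B where AB: "increment d A" "increment e B"
    and eq: "\<And>S x. finite S \<Longrightarrow> 0 \<notin> S \<Longrightarrow> x \<in> insert 0 S \<Longrightarrow> Suc x \<notin> S \<Longrightarrow> f (add_box S x) = f S + A S x"
      "\<And>S x. finite S \<Longrightarrow> 0 \<notin> S \<Longrightarrow> x \<in> insert 0 S \<Longrightarrow> Suc x \<notin> S \<Longrightarrow> g (add_box S x) = g S + B S x"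
    by metis
  \<comment> \<open>Discrete Leibniz rule; its cross term is why increments must be closed under
    multiplication.\<close>
  have "increment (d + e) (\<lambda>S x. A S x * g S + B S x * f S + A S x * B S x)"
    using increment_mult_filtered[OF AB(1) mult(2)] increment_mult_filtered[OF AB(2) mult(1)]
      increment_mult[OF AB] by (intro increment.add) (simp_all add: add.commute)
  then show ?case
    by (intro exI[of _ "\<lambda>S x. A S x * g S + B S x * f S + A S x * B S x"]) (simp add: eq algebra_simps)
next
  case (cong d f g)
  then obtain A where A: "increment d A"
    and eq: "\<And>S x. finite S \<Longrightarrow> 0 \<notin> S \<Longrightarrow> x \<in> insert 0 S \<Longrightarrow> Suc x \<notin> S \<Longrightarrow> f (add_box S x) = f S + A S x"
    by metis
  have "f (add_box S x) = g (add_box S x)" if "finite S" "0 \<notin> S" for S x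
    using that by (intro cong) (auto simp: add_box_def)
  then show ?case using A eq cong(2) by (intro exI[of _ A]) auto
next
  case (mono d f e)
  then show ?case using increment_mono by metis
qed

section \<open>Expected powers of the content of the new box\<close>

abbreviation content_moment :: "nat \<Rightarrow> nat set \<Rightarrow> rat" where
  "content_moment k S \<equiv> moment box_content (insert 0 S) lower_content S k"

text \<open>With \<open>j ^ m\<close> factored out, only the terms with \<open>m - i\<close> odd
  survive in \<open>(j + 1) ^ m - (j - 1) ^ m\<close>, and then \<open>m + i\<close> is odd as
  well.\<close>

lemma content_power_diff:
  "(of_nat j * (of_nat j + 1)) ^ m - (of_nat j * (of_nat j - 1)) ^ m =
    (\<Sum>i\<le>m. of_nat (m choose i) * (1 - (- 1) ^ (m - i)) * of_nat j ^ (m + i) :: rat)"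
proof -
  have "(of_nat j + 1 :: rat) ^ m - (of_nat j + (- 1)) ^ m =
      (\<Sum>i\<le>m. of_nat (m choose i) * (1 - (- 1) ^ (m - i)) * of_nat j ^ i)"
    unfolding binomial_ring by (simp add: sum_subtractf[symmetric] algebra_simps)
  then have "of_nat j ^ m * ((of_nat j + 1 :: rat) ^ m - (of_nat j + (- 1)) ^ m) =
      (\<Sum>i\<le>m. of_nat (m choose i) * (1 - (- 1) ^ (m - i)) * of_nat j ^ (m + i))"
    by (simp add: sum_distrib_left power_add mult_ac)
  then show ?thesis by (simp only: power_mult_distrib right_diff_distrib[symmetric] add_uminus_conv_diff)
qed

lemma filtered_power_diff:
  assumes "m > 0"
  shows "filtered (2 * m) (\<lambda>S. power_diff box_content (insert 0 S) lower_content S m)"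
proof (rule filtered.cong)
  show "filtered (2 * m) (\<lambda>S. \<Sum>i\<le>m. of_nat (m choose i) * (1 - (- 1) ^ (m - i)) * set_power_sum (m + i) S)"
  proof (rule filtered_sum)
    fix i assume i: "i \<in> {..m}"
    show "filtered (2 * m) (\<lambda>S. of_nat (m choose i) * (1 - (- 1) ^ (m - i)) * set_power_sum (m + i) S)"
    proof (cases "even (m - i)")
      case True then show ?thesis by (simp add: filtered.const)
    next
      case False
      then have "filtered (m + i) (set_power_sum (m + i))"
        using i by (intro filtered.psum) (auto simp: even_diff_nat)
      then have "filtered (2 * m) (set_power_sum (m + i))"
        using i by (auto intro: filtered.mono)
      then show ?thesis by (rule filtered_scale)
    qed
  qed
  fix S :: "nat set" assume S: "finite S" "0 \<notin> S"
  \<comment> \<open>The node 0 contributes nothing because \<open>m > 0\<close>.\<close>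
  have "power_diff box_content (insert 0 S) lower_content S m =
      (\<Sum>j\<in>S. (of_nat j * (of_nat j + 1)) ^ m - (of_nat j * (of_nat j - 1)) ^ m)"
    using S assms by (simp add: power_diff_def sum_subtractf box_content_def lower_content_def)
  also have "\<dots> = (\<Sum>i\<le>m. of_nat (m choose i) * (1 - (- 1) ^ (m - i)) * set_power_sum (m + i) S)"
    unfolding content_power_diff set_power_sum_def sum_distrib_left by (rule sum.swap)
  finally show "(\<Sum>i\<le>m. of_nat (m choose i) * (1 - (- 1) ^ (m - i)) * set_power_sum (m + i) S) =
      power_diff box_content (insert 0 S) lower_content S m" ..
qed

lemma inj_box_content: "inj_on box_content S"
  by (simp add: inj_on_def)

text \<open>Newton's recursion respects the bounds: \<open>2 * m\<close> from the power difference
  and \<open>2 * (k - m)\<close> from the earlier moment add up to \<open>2 * k\<close>.\<close>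

lemma filtered_content_moment: "filtered (2 * k) (content_moment k)"
proof (induction k rule: less_induct)
  case (less k)
  show ?case
  proof (cases "k = 0")
    case True
    show ?thesis unfolding True
    proof (rule filtered.cong[OF filtered.const[of _ 1]])
      fix S :: "nat set" assume S: "finite S" "0 \<notin> S"
      then show "1 = content_moment 0 S"
        using moment_0[OF _ _ inj_box_content, of "insert 0 S" S lower_content] by simp
    qed
  next
    case False
    show ?thesis
    proof (rule filtered.cong)
      have "filtered (2 * k) (\<lambda>S. power_diff box_content (insert 0 S) lower_content S m * content_moment (k - m) S)"
        if m: "m \<in> {1..k}" for m
        by (rule filtered.mono[OF filtered.mult[OF filtered_power_diff less.IH]]) (use m in auto)
      then show "filtered (2 * k) (\<lambda>S. (1 / of_nat k) * (\<Sum>m=1..k.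
          power_diff box_content (insert 0 S) lower_content S m * content_moment (k - m) S))"
        by (rule filtered_scale[OF filtered_sum])
      fix S :: "nat set" assume S: "finite S" "0 \<notin> S"
      then have rec: "of_nat k * content_moment k S = (\<Sum>m=1..k.
          power_diff box_content (insert 0 S) lower_content S m * content_moment (k - m) S)"
        by (intro moment_rec inj_box_content) auto
      show "(1 / of_nat k) * (\<Sum>m=1..k.
          power_diff box_content (insert 0 S) lower_content S m * content_moment (k - m) S) = content_moment k S"
        unfolding rec[symmetric] using False by simp
    qed
  qed
qed

text \<open>Averaging replaces \<open>box_content x ^ k\<close>, counted with degree
  \<open>2 * k\<close>, by \<open>content_moment k\<close>, which has the same bound. The strict
  bound \<open>d\<close> thus becomes \<open>d - 1\<close>.\<close>

lemma filtered_average: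
  assumes "increment d A"
  shows "filtered (d - 1) (\<lambda>S. \<Sum>x\<in>insert 0 S. transition S x * A S x)"
  using assms
proof induction
  case (zero d)
  then show ?case by (simp add: filtered.const)
next
  case (base e g k d)
  have "filtered (e + 2 * k) (\<lambda>S. g S * content_moment k S)"
    by (intro filtered.mult base filtered_content_moment)
  then have "filtered (d - 1) (\<lambda>S. g S * content_moment k S)"
    by (rule filtered.mono) (use base in auto)
  then show ?case
    by (simp add: moment_def transition_def sum_distrib_left mult.left_commute)
next
  case (add d A B)
  then show ?case using filtered.add by (simp add: distrib_left sum.distrib)
qed

lemma increment_0: "increment d A \<Longrightarrow> d = 0 \<Longrightarrow> A S x = 0"
  by (induction rule: increment.induct) auto

lemma sum_transition:
  assumes "finite S" "0 \<notin> S"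
  shows "(\<Sum>x\<in>insert 0 S. transition S x) = 1"
  using moment_0[OF _ _ inj_box_content, of "insert 0 S" S lower_content] assms
  by (simp add: moment_def transition_def)

section \<open>Averages over the shifted Plancherel measure\<close>

text \<open>The weight in the expectation after \<open>g_num\<close> is replaced by
  \<open>fact n\<close> times \<open>schur_weight\<close>: of the two factorials one
  cancels.\<close>

definition plancherel :: "nat \<Rightarrow> nat set \<Rightarrow> rat" where
  "plancherel n S = 2 ^ (n - card S) * fact n * schur_weight S ^ 2"

definition average :: "nat \<Rightarrow> (nat set \<Rightarrow> rat) \<Rightarrow> rat" where
  "average n F = (\<Sum>S\<in>strict_sets n. plancherel n S * F S)"

lemma finite_strict_sets: "finite (strict_sets n)"
proof (rule finite_subset)
  show "strict_sets n \<subseteq> Pow {..n}"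
    by (auto simp: strict_sets_def intro: member_le_sum[of _ _ "\<lambda>x. x", simplified])
qed simp

lemma card_strict_sets_le:
  assumes "S \<in> strict_sets n" shows "card S \<le> n"
proof -
  have "(\<Sum>x\<in>S. 1) \<le> \<Sum>S"
    using assms by (intro sum_mono) (auto simp: strict_sets_def Suc_le_eq intro: gr0I)
  then show ?thesis using assms by (simp add: strict_sets_def)
qed

lemma add_box_strict_sets:
  assumes S: "S \<in> strict_sets n" and x: "x \<in> insert 0 S" "Suc x \<notin> S"
  shows "add_box S x \<in> strict_sets (Suc n)"
    and "remove_box (add_box S x) x = S"
    and "card (add_box S x) = card S + (if x = 0 then 1 else 0)"
proof -
  have "\<Sum>S = x + \<Sum>(S - {x})"
    using S x by (cases "x = 0") (auto simp: strict_sets_def sum.remove)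
  then show "add_box S x \<in> strict_sets (Suc n)"
    using S x by (auto simp: strict_sets_def add_box_def)
  show "remove_box (add_box S x) x = S"
    using S x by (auto simp: remove_box_def add_box_def strict_sets_def)
  show "card (add_box S x) = card S + (if x = 0 then 1 else 0)"
    using S x card_Suc_Diff1[of S x] by (cases "x = 0") (auto simp: add_box_def strict_sets_def)
qed

lemma remove_box_strict_sets:
  assumes T: "T \<in> strict_sets (Suc n)" and x: "Suc x \<in> T" "x \<notin> T"
  shows "remove_box T x \<in> strict_sets n"
    and "add_box (remove_box T x) x = T"
    and "x \<in> insert 0 (remove_box T x)" and "Suc x \<notin> remove_box T x"
proof -
  have "\<Sum>T = Suc x + \<Sum>(T - {Suc x})"
    using T x by (auto simp: strict_sets_def sum.remove)
  moreover have "\<Sum>(remove_box T x) = x + \<Sum>(T - {Suc x})"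
  proof (cases "x = 0")
    case True
    with T have "remove_box T x = T - {Suc x}" by (auto simp: strict_sets_def remove_box_def)
    with True show ?thesis by simp
  next
    case False
    with T have "remove_box T x = insert x (T - {Suc x})" by (auto simp: strict_sets_def remove_box_def)
    then show ?thesis using T x by (simp add: strict_sets_def)
  qed
  ultimately show "remove_box T x \<in> strict_sets n"
    using T by (auto simp: strict_sets_def remove_box_def)
  show "add_box (remove_box T x) x = T"
    using T x by (auto simp: remove_box_def add_box_def strict_sets_def)
  show "x \<in> insert 0 (remove_box T x)" "Suc x \<notin> remove_box T x"
    using x by (auto simp: remove_box_def)
qed

text \<open>Both sides sum over pairs of strict partitions that differ by one box, grouped by the
  larger or by the smaller one.\<close>

lemma average_Suc:
  "average (Suc n) F = average n (\<lambda>S. \<Sum>x\<in>insert 0 S. transition S x * F (add_box S x))"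
proof -
  let ?X = "\<lambda>T. {x. Suc x \<in> T \<and> x \<notin> T}" and ?Y = "\<lambda>S. {x \<in> insert 0 S. Suc x \<notin> S}"
  let ?w = "\<lambda>T S. 2 ^ (Suc n - card T) * fact n * schur_weight T * schur_weight S * F T"
  have finX: "finite (?X T)" if "T \<in> strict_sets (Suc n)" for T
    by (rule finite_imageD[of Suc], rule finite_subset[of _ T]) (use that in \<open>auto simp: strict_sets_def\<close>)
  have finY: "finite (?Y S)" if "S \<in> strict_sets n" for S
    using that by (auto simp: strict_sets_def)
  have "average (Suc n) F = (\<Sum>T\<in>strict_sets (Suc n). \<Sum>x\<in>?X T. ?w T (remove_box T x))"
    unfolding average_def
  proof (rule sum.cong[OF refl])
    fix T assume T: "T \<in> strict_sets (Suc n)"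
    \<comment> \<open>The last factor \<open>Suc n\<close> of the factorial is
      \<open>\<Sum>T\<close>; with one copy of \<open>schur_weight T\<close> it becomes a sum over
      removable boxes.\<close>
    have "plancherel (Suc n) T * F T =
        2 ^ (Suc n - card T) * fact n * schur_weight T * F T * (of_nat (\<Sum>T) * schur_weight T)"
      using T by (simp add: plancherel_def power2_eq_square strict_sets_def mult_ac del: of_nat_Suc of_nat_sum)
    also have "\<dots> = 2 ^ (Suc n - card T) * fact n * schur_weight T * F T * (\<Sum>x\<in>?X T. schur_weight (remove_box T x))"
      using T by (subst sum_schur_weight_remove_box) (auto simp: strict_sets_def)
    finally show "plancherel (Suc n) T * F T = (\<Sum>x\<in>?X T. ?w T (remove_box T x))"
      by (simp add: sum_distrib_left mult_ac)
  qed
  also have "\<dots> = (\<Sum>(T, x)\<in>Sigma (strict_sets (Suc n)) ?X. ?w T (remove_box T x))"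
    using finite_strict_sets finX by (subst sum.Sigma) auto
  also have "\<dots> = (\<Sum>(S, x)\<in>Sigma (strict_sets n) ?Y. plancherel n S * (transition S x * F (add_box S x)))"
  proof (rule sum.reindex_bij_witness[where i = "\<lambda>(S, x). (add_box S x, x)" and j = "\<lambda>(T, x). (remove_box T x, x)"])
    fix p assume "p \<in> Sigma (strict_sets (Suc n)) ?X"
    then obtain T x where p: "p = (T, x)" and T: "T \<in> strict_sets (Suc n)" and x: "Suc x \<in> T" "x \<notin> T"
      by auto
    note rem = remove_box_strict_sets[OF T x]
    show "(case (case p of (T, x) \<Rightarrow> (remove_box T x, x)) of (S, x) \<Rightarrow> (add_box S x, x)) = p"
      using rem(2) p by simp
    show "(case p of (T, x) \<Rightarrow> (remove_box T x, x)) \<in> Sigma (strict_sets n) ?Y"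
      using rem p by simp
    define S where "S = remove_box T x"
    have S: "S \<in> strict_sets n" "x \<in> insert 0 S" "Suc x \<notin> S" and TS: "T = add_box S x"
      using rem by (auto simp: S_def)
    have "schur_weight S * transition S x = schur_weight T * (if x = 0 then 1 else 2)"
      unfolding TS using S by (intro schur_weight_add_box) (auto simp: strict_sets_def)
    then have "plancherel n S * (transition S x * F T) =
        2 ^ (n - card S) * (if x = 0 then 1 else 2) * fact n * schur_weight T * schur_weight S * F T"
      by (simp add: plancherel_def power2_eq_square mult_ac)
    \<comment> \<open>The number of parts grows exactly if \<open>x = 0\<close>, so the exponent
      absorbs the factor 1 or 2.\<close>
    also have "2 ^ (n - card S) * (if x = 0 then 1 else 2) = (2 :: rat) ^ (Suc n - card T)"
      using add_box_strict_sets(3)[OF S] card_strict_sets_le[OF S(1)] by (simp add: TS Suc_diff_le)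
    finally show "(case (case p of (T, x) \<Rightarrow> (remove_box T x, x)) of
        (S, x) \<Rightarrow> plancherel n S * (transition S x * F (add_box S x))) =
        (case p of (T, x) \<Rightarrow> ?w T (remove_box T x))"
      by (simp add: p S_def rem(2))
  next
    fix q assume "q \<in> Sigma (strict_sets n) ?Y"
    then obtain S x where q: "q = (S, x)" and S: "S \<in> strict_sets n" and x: "x \<in> insert 0 S" "Suc x \<notin> S"
      by blast
    show "(case (case q of (S, x) \<Rightarrow> (add_box S x, x)) of (T, x) \<Rightarrow> (remove_box T x, x)) = q"
      using add_box_strict_sets(2)[OF S x] q by simp
    show "(case q of (S, x) \<Rightarrow> (add_box S x, x)) \<in> Sigma (strict_sets (Suc n)) ?X"
      using add_box_strict_sets(1)[OF S x] q by (auto simp: add_box_def)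
  qed
  also have "\<dots> = (\<Sum>S\<in>strict_sets n. \<Sum>x\<in>?Y S. plancherel n S * (transition S x * F (add_box S x)))"
    using finite_strict_sets finY by (subst sum.Sigma) auto
  \<comment> \<open>Blocked rows are put back with transition weight 0.\<close>
  also have "\<dots> = (\<Sum>S\<in>strict_sets n. \<Sum>x\<in>insert 0 S. plancherel n S * (transition S x * F (add_box S x)))"
    by (intro sum.cong[OF refl] sum.mono_neutral_left)
      (auto simp: strict_sets_def transition_eq_0)
  finally show ?thesis by (simp add: average_def sum_distrib_left)
qed

text \<open>For \<open>d = 0\<close> the bound \<open>d - 1\<close> is 0 again, so the last clause
  is what lets the induction on \<open>d\<close> start.\<close>

lemma average_Suc_diff:
  assumes "filtered d f"
  shows "\<exists>h. filtered (d - 1) h \<and> (\<forall>n. average (Suc n) f = average n f + average n h) \<and> (d = 0 \<longrightarrow> h = (\<lambda>_. 0))"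
proof -
  obtain A where A: "increment d A" and eq: "\<And>S x. finite S \<Longrightarrow> 0 \<notin> S \<Longrightarrow> x \<in> insert 0 S \<Longrightarrow> Suc x \<notin> S \<Longrightarrow>
      f (add_box S x) = f S + A S x"
    using filtered_add_box[OF assms] by metis
  let ?h = "\<lambda>S. \<Sum>x\<in>insert 0 S. transition S x * A S x"
  have "average (Suc n) f = average n f + average n ?h" for n
  proof -
    have "(\<Sum>x\<in>insert 0 S. transition S x * f (add_box S x)) = f S + ?h S" if "S \<in> strict_sets n" for S
    proof -
      have S: "finite S" "0 \<notin> S" using that by (auto simp: strict_sets_def)
      have "(\<Sum>x\<in>insert 0 S. transition S x * f (add_box S x)) =
          (\<Sum>x\<in>insert 0 S. transition S x * (f S + A S x))"
      proof (rule sum.cong[OF refl])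
        fix x assume x: "x \<in> insert 0 S"
        show "transition S x * f (add_box S x) = transition S x * (f S + A S x)"
          using eq[OF S x] transition_eq_0[OF S(1)] by (cases "Suc x \<in> S") simp_all
      qed
      also have "\<dots> = (\<Sum>x\<in>insert 0 S. transition S x) * f S + ?h S"
        by (simp only: distrib_left sum.distrib sum_distrib_right)
      finally show ?thesis by (simp only: sum_transition[OF S] mult_1)
    qed
    then show ?thesis
      unfolding average_Suc by (simp add: average_def distrib_left sum.distrib cong: sum.cong)
  qed
  moreover have "?h = (\<lambda>_. 0)" if "d = 0"
    using increment_0[OF A that] by simp
  ultimately show ?thesis using filtered_average[OF A] by blast
qed

section \<open>From differences to polynomials via binomial coefficients\<close>

lemma newton_expansion_antidifference:
  fixes g :: "nat \<Rightarrow> rat"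
  assumes "\<And>n. g (Suc n) - g n = (\<Sum>k<d. a k * of_nat (n choose k))"
  shows "g n = g 0 + (\<Sum>k<d. a k * of_nat (n choose Suc k))"
proof (induction n)
  case (Suc n)
  have "g (Suc n) = g n + (\<Sum>k<d. a k * of_nat (n choose k))"
    using assms[of n] by simp
  \<comment> \<open>Pascal's rule: passing to \<open>Suc n\<close> adds \<open>n choose k\<close> to
    \<open>n choose Suc k\<close>.\<close>
  then show ?case unfolding Suc.IH by (simp add: sum.distrib distrib_left)
qed simp

lemma average_newton_expansion:
  "filtered d f \<Longrightarrow> \<exists>m a. \<forall>n. average n f = (\<Sum>k<m. a k * of_nat (n choose k))"
proof (induction d arbitrary: f)
  case 0
  then obtain h where "\<And>n. average (Suc n) f = average n f + average n h" "h = (\<lambda>_. 0)"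
    using average_Suc_diff by blast
  then have "average n f = average 0 f" for n
    by (induction n) (simp_all add: average_def)
  then show ?case by (intro exI[of _ 1] exI[of _ "\<lambda>_. average 0 f"]) simp
next
  case (Suc d)
  then obtain h where h: "filtered d h" "\<And>n. average (Suc n) f = average n f + average n h"
    using average_Suc_diff by fastforce
  obtain m a where a: "\<And>n. average n h = (\<Sum>k<m. a k * of_nat (n choose k))"
    using Suc.IH[OF h(1)] by blast
  have eq: "average n f = average 0 f + (\<Sum>k<m. a k * of_nat (n choose Suc k))" for n
    using h(2) a by (intro newton_expansion_antidifference) simp
  show ?case
  proof (intro exI allI)
    fix n
    show "average n f = (\<Sum>k<Suc m. (case k of 0 \<Rightarrow> average 0 f | Suc k \<Rightarrow> a k) * of_nat (n choose k))"
      unfolding sum.lessThan_Suc_shift by (subst eq) simp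
  qed
qed

lemma binomial_poly:
  "of_nat (n choose k) = (poly (smult (1 / fact k) (\<Prod>i=0..<k. [:- of_nat i, 1:])) (of_nat n) :: rat)"
  by (simp add: binomial_gbinomial gbinomial_prod_rev poly_prod)

lemma average_polynomial:
  assumes "filtered d f"
  shows "\<exists>\<Phi> :: rat poly. \<forall>n. average n f = poly \<Phi> (of_nat n)"
proof -
  obtain m a where "\<And>n. average n f = (\<Sum>k<m. a k * of_nat (n choose k))"
    using average_newton_expansion[OF assms] by blast
  then show ?thesis
    by (intro exI[of _ "\<Sum>k<m. smult (a k) (smult (1 / fact k) (\<Prod>i=0..<k. [:- of_nat i, 1:]))"])
      (simp only: binomial_poly poly_sum poly_smult simp_thms)
qed

section \<open>Counting shifted standard tableaux\<close>

lemma strict_partition_iff: "strict_partition \<mu> \<longleftrightarrow> sorted_wrt (>) \<mu> \<and> 0 \<notin> set \<mu>"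
proof -
  have "sorted_wrt (\<ge>) \<mu> \<and> distinct \<mu> \<longleftrightarrow> sorted_wrt (>) \<mu>"
    by (induction \<mu>) (auto simp: order.strict_iff_order)
  then show ?thesis unfolding strict_partition_def is_partition_def by (metis neq0_conv)
qed

lemma strict_partition_eqI:
  assumes "strict_partition \<mu>" "strict_partition \<nu>" "set \<mu> = set \<nu>"
  shows "\<mu> = \<nu>"
proof -
  have "sorted_wrt (<) (rev \<mu>)" "sorted_wrt (<) (rev \<nu>)"
    using assms by (simp_all add: strict_partition_iff sorted_wrt_rev)
  then have "rev \<mu> = rev \<nu>" using assms(3) by (intro strict_sorted_equal) auto
  then show ?thesis by simp
qed

lemma sum_set_strict_partition: "strict_partition \<mu> \<Longrightarrow> \<Sum>(set \<mu>) = sum_list \<mu>"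
  by (simp add: strict_partition_def distinct_sum_list_conv_Sum)

lemma set_SP: "\<mu> \<in> SP n \<Longrightarrow> set \<mu> \<in> strict_sets n"
  by (auto simp: SP_def strict_sets_def sum_set_strict_partition strict_partition_iff)

lemma bij_betw_set_SP: "bij_betw set (SP n) (strict_sets n)"
proof (rule bij_betw_imageI)
  show "inj_on set (SP n)"
    by (auto simp: inj_on_def SP_def intro: strict_partition_eqI)
  show "set ` SP n = strict_sets n"
  proof
    show "strict_sets n \<subseteq> set ` SP n"
    proof
      fix S assume S: "S \<in> strict_sets n"
      let ?\<mu> = "rev (sorted_list_of_set S)"
      have set: "set ?\<mu> = S" using S by (simp add: strict_sets_def)
      have "strict_partition ?\<mu>"
        using S set by (simp add: strict_partition_iff sorted_wrt_rev strict_sets_def)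
      then have "?\<mu> \<in> SP n"
        using sum_set_strict_partition[of ?\<mu>] S unfolding set by (simp add: SP_def strict_sets_def)
      then show "S \<in> set ` SP n" using set by (metis imageI)
    qed
  qed (auto simp: set_SP)
qed

section \<open>Adding a box, in terms of row lengths\<close>

definition row_length :: "nat list \<Rightarrow> nat \<Rightarrow> nat" where
  "row_length \<mu> i = (if i < length \<mu> then \<mu> ! i else 0)"

definition box_step :: "nat list \<Rightarrow> nat list \<Rightarrow> bool" where
  "box_step \<nu> \<mu> \<longleftrightarrow> (\<exists>b. b \<notin> shifted_diagram \<nu> \<and> shifted_diagram \<mu> = insert b (shifted_diagram \<nu>))"

text \<open>Row \<open>i\<close>, counted from 0, starts on the diagonal in column
  \<open>i + 1\<close>, so its \<open>k\<close>-th box, counted from 1, lies in column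
  \<open>i + k\<close>.\<close>

lemma shifted_diagram_row:
  "(int i + 1, int i + int k) \<in> shifted_diagram \<mu> \<longleftrightarrow> 1 \<le> k \<and> k \<le> row_length \<mu> i"
  by (auto simp: shifted_diagram_def row_length_def)

lemma shifted_diagram_cases:
  assumes "b \<in> shifted_diagram \<mu>"
  obtains i k where "b = (int i + 1, int i + int k)"
proof -
  obtain u v where "b = (u, v)" "1 \<le> u" "u \<le> v" using assms by (auto simp: shifted_diagram_def)
  then have "b = (int (nat (u - 1)) + 1, int (nat (u - 1)) + int (nat (v - u + 1)))" by simp
  then show ?thesis by (rule that)
qed

text \<open>As \<open>row_length\<close> is 0 past the last part, opening a row and lengthening one
  are the same update.\<close>

lemma box_step_row: "box_step \<nu> \<mu> \<longleftrightarrow> (\<exists>i. row_length \<mu> = (row_length \<nu>)(i := Suc (row_length \<nu> i)))"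
proof
  assume "box_step \<nu> \<mu>"
  then obtain b where b: "b \<notin> shifted_diagram \<nu>" "shifted_diagram \<mu> = insert b (shifted_diagram \<nu>)"
    by (auto simp: box_step_def)
  then have "b \<in> shifted_diagram \<mu>" by simp
  then obtain i k where bik: "b = (int i + 1, int i + int k)" by (rule shifted_diagram_cases)
  have mem: "1 \<le> l \<and> l \<le> row_length \<mu> j \<longleftrightarrow> (j = i \<and> l = k) \<or> (1 \<le> l \<and> l \<le> row_length \<nu> j)" for j l
    using b(2) shifted_diagram_row[of j l \<mu>] shifted_diagram_row[of j l \<nu>] by (auto simp: bik)
  have k: "1 \<le> k" "row_length \<nu> i < k" "k \<le> row_length \<mu> i"
    using b bik shifted_diagram_row[of i k \<nu>] mem[of k i] by auto
  have "row_length \<mu> j = ((row_length \<nu>)(i := Suc (row_length \<nu> i))) j" for j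
  proof (cases "j = i")
    case True
    \<comment> \<open>A larger \<open>k\<close> would leave a gap in row \<open>i\<close>, and a
      longer row would contain a second new box.\<close>
    have "k = Suc (row_length \<nu> i)" using k mem[of "Suc (row_length \<nu> i)" i] by auto
    moreover have "row_length \<mu> i = k" using k mem[of "row_length \<mu> i" i] by auto
    ultimately show ?thesis using True by simp
  next
    case False
    then show ?thesis using mem[of "row_length \<mu> j" j] mem[of "row_length \<nu> j" j] by force
  qed
  then show "\<exists>i. row_length \<mu> = (row_length \<nu>)(i := Suc (row_length \<nu> i))" by blast
next
  assume "\<exists>i. row_length \<mu> = (row_length \<nu>)(i := Suc (row_length \<nu> i))"
  then obtain i where i: "row_length \<mu> = (row_length \<nu>)(i := Suc (row_length \<nu> i))" ..
  let ?b = "(int i + 1, int i + int (Suc (row_length \<nu> i)))"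
  have "?b \<notin> shifted_diagram \<nu>" unfolding shifted_diagram_row by simp
  moreover have "shifted_diagram \<mu> = insert ?b (shifted_diagram \<nu>)"
  proof -
    have *: "p \<in> shifted_diagram \<mu> \<longleftrightarrow> p \<in> insert ?b (shifted_diagram \<nu>)"
      if "p = (int j + 1, int j + int l)" for p j l
      unfolding that insert_iff shifted_diagram_row i by auto
    show ?thesis
    proof (intro equalityI subsetI)
      fix p assume "p \<in> shifted_diagram \<mu>"
      then show "p \<in> insert ?b (shifted_diagram \<nu>)" using * by (metis shifted_diagram_cases)
    next
      fix p assume "p \<in> insert ?b (shifted_diagram \<nu>)"
      then show "p \<in> shifted_diagram \<mu>" using * by (metis insertE shifted_diagram_cases)
    qed
  qed
  ultimately show "box_step \<nu> \<mu>" unfolding box_step_def by blast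
qed

lemma row_inj:
  assumes "strict_partition \<mu>" "row_length \<mu> i = row_length \<mu> j" "row_length \<mu> i \<noteq> 0"
  shows "i = j"
  using assms by (auto simp: row_length_def strict_partition_def nth_eq_iff_index_eq split: if_splits)

lemma in_set_row_iff:
  assumes "strict_partition \<mu>"
  shows "y \<in> set \<mu> \<longleftrightarrow> y \<noteq> 0 \<and> (\<exists>i. row_length \<mu> i = y)"
  using assms by (fastforce simp: row_length_def in_set_conv_nth strict_partition_iff split: if_splits)

text \<open>A positive unblocked row grows in place: the parts before it exceed \<open>x\<close> and
  differ from \<open>Suc x\<close>, so the order stays strict. For \<open>x = 0\<close> all parts
  exceed 1, and a part 1 is appended.\<close>

lemma add_box_partition:
  assumes \<nu>: "strict_partition \<nu>" and x: "x \<in> insert 0 (set \<nu>)" "Suc x \<notin> set \<nu>"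
  shows "\<exists>\<mu>. strict_partition \<mu> \<and> set \<mu> = add_box (set \<nu>) x \<and> box_step \<nu> \<mu>"
proof (cases "x = 0")
  case True
  have "1 < y" if "y \<in> set \<nu>" for y
    using that \<nu> x True by (cases "y = 0 \<or> y = 1") (auto simp: strict_partition_iff)
  then have "strict_partition (\<nu> @ [1])"
    using \<nu> by (auto simp: strict_partition_iff sorted_wrt_append)
  moreover have "set (\<nu> @ [1]) = add_box (set \<nu>) x"
    using True \<nu> by (auto simp: add_box_def strict_partition_iff)
  moreover have "row_length (\<nu> @ [1]) = (row_length \<nu>)(length \<nu> := Suc (row_length \<nu> (length \<nu>)))"
    by (auto simp: row_length_def nth_append)
  ultimately show ?thesis unfolding box_step_row by blast
next
  case False
  then obtain i where i: "i < length \<nu>" "\<nu> ! i = x" using x by (auto simp: in_set_conv_nth)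
  let ?\<mu> = "\<nu>[i := Suc x]"
  have dec: "\<nu> ! k < \<nu> ! j" if "j < k" "k < length \<nu>" for j k
    using \<nu> that by (auto simp: strict_partition_iff sorted_wrt_iff_nth_less)
  have ne: "\<nu> ! j \<noteq> Suc x" if "j < length \<nu>" for j
    using x that by (metis nth_mem)
  have "sorted_wrt (>) ?\<mu>"
    unfolding sorted_wrt_iff_nth_less
  proof (intro allI impI)
    fix j k assume jk: "j < k" "k < length ?\<mu>"
    then show "?\<mu> ! k < ?\<mu> ! j"
      using dec[of j k] ne[of j] i by (auto simp: nth_list_update)
  qed
  moreover have set: "set ?\<mu> = add_box (set \<nu>) x"
    using \<nu> i by (simp add: set_update_distinct strict_partition_def add_box_def)
  ultimately have "strict_partition ?\<mu>"
    using \<nu> by (auto simp: strict_partition_iff add_box_def)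
  moreover have "row_length ?\<mu> = (row_length \<nu>)(i := Suc (row_length \<nu> i))"
    using i by (auto simp: row_length_def)
  ultimately show ?thesis using set unfolding box_step_row by blast
qed

lemma box_step_iff:
  assumes \<nu>: "strict_partition \<nu>" and \<mu>: "strict_partition \<mu>"
  shows "box_step \<nu> \<mu> \<longleftrightarrow> (\<exists>x\<in>insert 0 (set \<nu>). Suc x \<notin> set \<nu> \<and> set \<mu> = add_box (set \<nu>) x)"
proof
  assume "box_step \<nu> \<mu>"
  then obtain i where i: "row_length \<mu> = (row_length \<nu>)(i := Suc (row_length \<nu> i))" by (auto simp: box_step_row)
  let ?x = "row_length \<nu> i"
  have "?x \<in> insert 0 (set \<nu>)" using in_set_row_iff[OF \<nu>] by auto
  \<comment> \<open>Otherwise \<open>\<mu>\<close> would have two rows of equal positive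
    length.\<close>
  moreover have other: "row_length \<nu> j \<noteq> Suc ?x" for j
  proof
    assume eq: "row_length \<nu> j = Suc ?x"
    then have "j \<noteq> i" by auto
    with i eq have "row_length \<mu> j = Suc ?x" "row_length \<mu> i = Suc ?x" by auto
    with row_inj[OF \<mu>, of i j] \<open>j \<noteq> i\<close> show False by simp
  qed
  then have "Suc ?x \<notin> set \<nu>" using in_set_row_iff[OF \<nu>] by blast
  moreover have "set \<mu> = add_box (set \<nu>) ?x"
  proof (rule set_eqI)
    fix y
    show "y \<in> set \<mu> \<longleftrightarrow> y \<in> add_box (set \<nu>) ?x"
    proof (cases "y = 0 \<or> y = Suc ?x")
      case True
      then show ?thesis using in_set_row_iff[OF \<mu>] in_set_row_iff[OF \<nu>] i by (auto simp: add_box_def)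
    next
      case False
      then have "(\<exists>j. row_length \<mu> j = y) \<longleftrightarrow> (\<exists>j. j \<noteq> i \<and> row_length \<nu> j = y)" by (auto simp: i)
      \<comment> \<open>Parts are distinct, so a positive old length of row \<open>i\<close>
        disappears.\<close>
      also have "\<dots> \<longleftrightarrow> (\<exists>j. row_length \<nu> j = y) \<and> y \<noteq> ?x"
        using False row_inj[OF \<nu>, of i] by metis
      finally show ?thesis
        using False in_set_row_iff[OF \<mu>] in_set_row_iff[OF \<nu>] by (auto simp: add_box_def)
    qed
  qed
  ultimately show "\<exists>x\<in>insert 0 (set \<nu>). Suc x \<notin> set \<nu> \<and> set \<mu> = add_box (set \<nu>) x" by blast
next
  assume "\<exists>x\<in>insert 0 (set \<nu>). Suc x \<notin> set \<nu> \<and> set \<mu> = add_box (set \<nu>) x"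
  then obtain x where "x \<in> insert 0 (set \<nu>)" "Suc x \<notin> set \<nu>" "set \<mu> = add_box (set \<nu>) x" by blast
  with add_box_partition[OF \<nu>] strict_partition_eqI[OF \<mu>] show "box_step \<nu> \<mu>" by metis
qed

lemma sum_list_box_step:
  assumes "strict_partition \<nu>" "strict_partition \<mu>" "box_step \<nu> \<mu>"
  shows "sum_list \<mu> = Suc (sum_list \<nu>)"
proof -
  obtain x where x: "x \<in> insert 0 (set \<nu>)" "Suc x \<notin> set \<nu>" "set \<mu> = add_box (set \<nu>) x"
    using assms by (auto simp: box_step_iff)
  have "set \<nu> \<in> strict_sets (sum_list \<nu>)" using assms(1) by (intro set_SP) (simp add: SP_def)
  from add_box_strict_sets(1)[OF this x(1,2)] have "\<Sum>(set \<mu>) = Suc (sum_list \<nu>)"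
    by (simp add: x(3) strict_sets_def)
  then show ?thesis using assms(2) by (simp add: sum_set_strict_partition)
qed

section \<open>The recursion for chains and Schur's formula\<close>

lemma shifted_chains_Suc:
  assumes \<mu>: "\<mu> \<in> SP (Suc n)"
  shows "shifted_chains \<mu> = (\<Union>\<nu>\<in>{\<nu>\<in>SP n. box_step \<nu> \<mu>}. (\<lambda>c. c @ [\<mu>]) ` shifted_chains \<nu>)"
proof (intro equalityI subsetI)
  have \<mu>': "strict_partition \<mu>" "sum_list \<mu> = Suc n" using \<mu> by (auto simp: SP_def)
  fix c assume "c \<in> shifted_chains \<mu>"
  then have c: "length c = Suc (Suc n)" "c ! 0 = []" "c ! Suc n = \<mu>"
      "\<And>i. i \<le> Suc n \<Longrightarrow> strict_partition (c ! i)" "\<And>i. i < Suc n \<Longrightarrow> box_step (c ! i) (c ! Suc i)"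
    by (auto simp: shifted_chains_def \<mu>' box_step_def)
  let ?\<nu> = "c ! n"
  have \<nu>: "strict_partition ?\<nu>" "box_step ?\<nu> \<mu>" using c(4)[of n] c(5)[of n] c(3) by auto
  then have sum: "sum_list ?\<nu> = n" using sum_list_box_step[OF \<nu>(1) \<mu>'(1) \<nu>(2)] \<mu>' by simp
  have "take (Suc n) c \<in> shifted_chains ?\<nu>"
    using c by (auto simp: shifted_chains_def sum box_step_def)
  moreover have "c = take (Suc n) c @ [\<mu>]"
    using c by (metis lessI take_Suc_conv_app_nth take_all le_refl)
  ultimately show "c \<in> (\<Union>\<nu>\<in>{\<nu>\<in>SP n. box_step \<nu> \<mu>}. (\<lambda>c. c @ [\<mu>]) ` shifted_chains \<nu>)"
    using \<nu> sum by (auto simp: SP_def)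
next
  have \<mu>': "strict_partition \<mu>" "sum_list \<mu> = Suc n" using \<mu> by (auto simp: SP_def)
  fix c assume "c \<in> (\<Union>\<nu>\<in>{\<nu>\<in>SP n. box_step \<nu> \<mu>}. (\<lambda>c. c @ [\<mu>]) ` shifted_chains \<nu>)"
  then obtain \<nu> c' where \<nu>: "\<nu> \<in> SP n" "box_step \<nu> \<mu>" and c': "c' \<in> shifted_chains \<nu>" and c: "c = c' @ [\<mu>]"
    by auto
  have sum: "sum_list \<nu> = n" using \<nu> by (simp add: SP_def)
  have len: "length c' = Suc n" and last: "c' ! n = \<nu>" using c' by (auto simp: shifted_chains_def sum)
  have "strict_partition (c ! i)" if "i \<le> Suc n" for i
    using that c' \<mu>' len by (auto simp: c nth_append shifted_chains_def sum)
  moreover have "box_step (c ! i) (c ! Suc i)" if "i < Suc n" for i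
    using that c' \<nu> len last by (cases "i = n") (auto simp: c nth_append shifted_chains_def sum box_step_def)
  ultimately show "c \<in> shifted_chains \<mu>"
    using c' len by (auto simp: shifted_chains_def \<mu>' box_step_def c nth_append)
qed

lemma g_num_Suc:
  assumes \<mu>: "\<mu> \<in> SP (Suc n)"
  shows "g_num \<mu> = (\<Sum>\<nu>\<in>{\<nu>\<in>SP n. box_step \<nu> \<mu>}. g_num \<nu>)"
proof -
  let ?A = "{\<nu>\<in>SP n. box_step \<nu> \<mu>}" and ?C = "\<lambda>\<nu>. (\<lambda>c. c @ [\<mu>]) ` shifted_chains \<nu>"
  \<comment> \<open>The last but one entry of an extended chain recovers
    \<open>\<nu>\<close>.\<close>
  have "?C \<nu> \<inter> ?C \<nu>' = {}" if "\<nu> \<in> ?A" "\<nu>' \<in> ?A" "\<nu> \<noteq> \<nu>'" for \<nu> \<nu>'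
    using that by (auto simp: shifted_chains_def SP_def)
  then have "card (\<Union>\<nu>\<in>?A. ?C \<nu>) = (\<Sum>\<nu>\<in>?A. card (?C \<nu>))"
    by (intro card_UN_disjoint) (auto simp: finite_SP finite_shifted_chains)
  also have "\<dots> = (\<Sum>\<nu>\<in>?A. g_num \<nu>)"
    unfolding g_num_def by (intro sum.cong refl card_image) (auto simp: inj_on_def)
  finally show ?thesis unfolding g_num_def shifted_chains_Suc[OF \<mu>] .
qed

lemma shifted_chains_empty: "shifted_chains [] = {[[]]}"
proof -
  have "c \<in> shifted_chains [] \<longleftrightarrow> c = [[]]" for c
    by (cases c) (auto simp: shifted_chains_def strict_partition_def is_partition_def)
  then show ?thesis by blast
qed

lemma inj_on_remove_box: "inj_on (remove_box T) {x. Suc x \<in> T \<and> x \<notin> T}"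
proof (rule inj_onI, rule ccontr)
  fix x y
  assume x: "x \<in> {x. Suc x \<in> T \<and> x \<notin> T}" and eq: "remove_box T x = remove_box T y" and "x \<noteq> y"
  then have "Suc x \<in> remove_box T y" by (auto simp: remove_box_def)
  then have "Suc x \<in> remove_box T x" by (simp only: eq)
  then show False by (simp add: remove_box_def)
qed

text \<open>Schur's formula: both sides obey the same recursion over the partitions one box below,
  the count by dropping the last step of a chain, the product by
  \<open>sum_schur_weight_remove_box\<close>.\<close>

lemma g_num_eq_schur_weight:
  "\<mu> \<in> SP n \<Longrightarrow> of_nat (g_num \<mu>) = fact n * schur_weight (set \<mu>)"
proof (induction n arbitrary: \<mu>)
  case 0
  then have "\<mu> = []" by (cases \<mu>) (auto simp: SP_def strict_partition_iff)
  then show ?case by (simp add: g_num_def shifted_chains_empty)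
next
  case (Suc n)
  let ?A = "{\<nu>\<in>SP n. box_step \<nu> \<mu>}" and ?X = "{x. Suc x \<in> set \<mu> \<and> x \<notin> set \<mu>}"
  have T: "set \<mu> \<in> strict_sets (Suc n)" and \<mu>: "strict_partition \<mu>"
    using set_SP[OF Suc.prems] Suc.prems by (auto simp: SP_def)
  have "set ` ?A = remove_box (set \<mu>) ` ?X"
  proof (intro equalityI subsetI)
    fix S assume "S \<in> set ` ?A"
    then obtain \<nu> where \<nu>: "\<nu> \<in> SP n" "box_step \<nu> \<mu>" "S = set \<nu>" by auto
    then obtain x where x: "x \<in> insert 0 S" "Suc x \<notin> S" "set \<mu> = add_box S x"
      using \<mu> by (auto simp: SP_def box_step_iff)
    have "remove_box (set \<mu>) x = S"
      using add_box_strict_sets(2)[OF set_SP[OF \<nu>(1)]] x \<nu>(3) by simp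
    moreover have "x \<in> ?X" using x by (auto simp: add_box_def)
    ultimately show "S \<in> remove_box (set \<mu>) ` ?X" by blast
  next
    fix S assume "S \<in> remove_box (set \<mu>) ` ?X"
    then obtain x where x: "Suc x \<in> set \<mu>" "x \<notin> set \<mu>" and S: "S = remove_box (set \<mu>) x" by auto
    note rem = remove_box_strict_sets[OF T x, folded S]
    obtain \<nu> where \<nu>: "\<nu> \<in> SP n" "S = set \<nu>"
      using rem(1) bij_betw_imp_surj_on[OF bij_betw_set_SP[of n]] by auto
    then have "box_step \<nu> \<mu>"
      using rem(2-4) \<mu> by (subst box_step_iff) (auto simp: SP_def)
    with \<nu> show "S \<in> set ` ?A" by auto
  qed
  moreover have "inj_on set ?A"
    by (rule inj_on_subset[OF bij_betw_imp_inj_on[OF bij_betw_set_SP]]) auto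
  ultimately have "(\<Sum>\<nu>\<in>?A. schur_weight (set \<nu>)) = (\<Sum>x\<in>?X. schur_weight (remove_box (set \<mu>) x))"
    using sum.reindex[of set ?A schur_weight] sum.reindex[OF inj_on_remove_box, of schur_weight "set \<mu>"]
    by simp
  also have "\<dots> = of_nat (\<Sum>(set \<mu>)) * schur_weight (set \<mu>)"
    using T by (intro sum_schur_weight_remove_box) (auto simp: strict_sets_def)
  also have "\<Sum>(set \<mu>) = Suc n" using T by (simp add: strict_sets_def)
  finally have "fact n * (\<Sum>\<nu>\<in>?A. schur_weight (set \<nu>)) = fact (Suc n) * schur_weight (set \<mu>)"
    by (simp add: mult_ac)
  then show ?case
    by (simp add: g_num_Suc[OF Suc.prems] Suc.IH sum_distrib_left)
qed

lemma expectation_eq_average: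
  assumes "\<And>\<mu>. strict_partition \<mu> \<Longrightarrow> eval_at_partition f \<mu> = F (set \<mu>)"
  shows "expectation n f = average n F"
proof -
  have "expectation n f = (\<Sum>\<mu>\<in>SP n. plancherel n (set \<mu>) * F (set \<mu>))"
    unfolding expectation_def
  proof (rule sum.cong[OF refl])
    fix \<mu> assume \<mu>: "\<mu> \<in> SP n"
    then have "strict_partition \<mu>" by (simp add: SP_def)
    moreover from this have "card (set \<mu>) = length \<mu>"
      by (simp add: strict_partition_def distinct_card)
    ultimately show "2 ^ (n - length \<mu>) * of_nat (g_num \<mu>) ^ 2 / fact n * eval_at_partition f \<mu> =
        plancherel n (set \<mu>) * F (set \<mu>)"
      using assms[of \<mu>] by (simp add: g_num_eq_schur_weight[OF \<mu>] plancherel_def power2_eq_square)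
  qed
  also have "\<dots> = average n F"
    unfolding average_def by (rule sum.reindex_bij_betw[OF bij_betw_set_SP])
  finally show ?thesis .
qed

section \<open>Evaluation of supersymmetric functions\<close>

definition monomial_value :: "(nat \<Rightarrow> rat) \<Rightarrow> monomial \<Rightarrow> rat" where
  "monomial_value x m = (\<Prod>i\<in>Poly_Mapping.keys m. x i ^ Poly_Mapping.lookup m i)"

lemma evaluate_eq: "evaluate f x = Sum_any (\<lambda>m. f m * monomial_value x m)"
  by (simp add: evaluate_def monomial_value_def)

lemma finite_evaluation_support:
  "f \<in> symmetric_functions \<Longrightarrow> finite {i. x i \<noteq> 0} \<Longrightarrow> finite {m. f m * monomial_value x m \<noteq> 0}"
  unfolding monomial_value_def by (rule finite_evaluation)

lemma monomial_value_add: "monomial_value x (a + b) = monomial_value x a * monomial_value x b"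
proof -
  let ?K = "Poly_Mapping.keys a \<union> Poly_Mapping.keys b"
  have *: "monomial_value x m = (\<Prod>i\<in>?K. x i ^ Poly_Mapping.lookup m i)" if "Poly_Mapping.keys m \<subseteq> ?K" for m
    unfolding monomial_value_def using that
    by (intro prod.mono_neutral_left) (auto simp: in_keys_iff)
  show ?thesis
    using Poly_Mapping.keys_add[of a b] by (simp add: * lookup_add power_add prod.distrib)
qed

lemma evaluate_const: "evaluate (series_const c) x = c"
proof -
  have "evaluate (series_const c) x = (\<Sum>m\<in>{0}. series_const c m * monomial_value x m)"
    unfolding evaluate_eq by (rule Sum_any.expand_superset) (auto simp: series_const_def)
  then show ?thesis by (simp add: series_const_def monomial_value_def)
qed

lemma evaluate_add:
  assumes "f \<in> symmetric_functions" "g \<in> symmetric_functions" "finite {i. x i \<noteq> 0}"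
  shows "evaluate (series_add f g) x = evaluate f x + evaluate g x"
  unfolding evaluate_eq series_add_def distrib_right
  by (intro Sum_any.distrib finite_evaluation_support assms)

lemma evaluate_power_sum:
  assumes r: "r > 0" and K: "finite K" and x: "\<And>i. i \<notin> K \<Longrightarrow> x i = 0"
  shows "evaluate (power_sum r) x = (\<Sum>i\<in>K. x i ^ r)"
proof -
  have val: "monomial_value x (Poly_Mapping.single i r) = x i ^ r" for i
    using r by (simp add: monomial_value_def)
  have coeff: "power_sum r (Poly_Mapping.single i r) = 1" for i
    by (auto simp: power_sum_def)
  have "evaluate (power_sum r) x = (\<Sum>m\<in>(\<lambda>i. Poly_Mapping.single i r) ` K. power_sum r m * monomial_value x m)"
    unfolding evaluate_eq
  proof (rule Sum_any.expand_superset)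
    show "{m. power_sum r m * monomial_value x m \<noteq> 0} \<subseteq> (\<lambda>i. Poly_Mapping.single i r) ` K"
    proof
      fix m assume "m \<in> {m. power_sum r m * monomial_value x m \<noteq> 0}"
      then obtain i where "m = Poly_Mapping.single i r" "monomial_value x m \<noteq> 0"
        by (auto simp: power_sum_def split: if_splits)
      moreover from this have "i \<in> K" using x[of i] r by (auto simp: val)
      ultimately show "m \<in> (\<lambda>i. Poly_Mapping.single i r) ` K" by blast
    qed
  qed (use K in simp)
  \<comment> \<open>For \<open>r = 0\<close> these monomials would all coincide.\<close>
  also have "inj_on (\<lambda>i. Poly_Mapping.single i r) K"
    using r by (auto simp: inj_on_def) (metis lookup_single_eq lookup_single_not_eq neq0_conv)
  then have "(\<Sum>m\<in>(\<lambda>i. Poly_Mapping.single i r) ` K. power_sum r m * monomial_value x m) = (\<Sum>i\<in>K. x i ^ r)"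
    by (simp add: sum.reindex val coeff)
  finally show ?thesis .
qed

text \<open>Restricting both factors to the finitely many monomials that contribute at
  \<open>x\<close> leaves a finite product of sums, regrouped by the monomial
  \<open>a + b\<close>.\<close>

lemma evaluate_mult:
  assumes f: "f \<in> symmetric_functions" and g: "g \<in> symmetric_functions" and x: "finite {i. x i \<noteq> 0}"
  shows "evaluate (series_mult f g) x = evaluate f x * evaluate g x"
proof -
  let ?v = "monomial_value x"
  let ?A = "{m. f m * ?v m \<noteq> 0}" and ?B = "{m. g m * ?v m \<noteq> 0}"
  let ?h = "\<lambda>p. (f (fst p) * ?v (fst p)) * (g (snd p) * ?v (snd p))"
  let ?s = "\<lambda>p. fst p + snd p :: monomial"
  note fin = finite_evaluation_support[OF f x] finite_evaluation_support[OF g x]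
  have val: "series_mult f g m * ?v m = (\<Sum>p\<in>{p \<in> ?A \<times> ?B. ?s p = m}. ?h p)" for m
  proof -
    have "series_mult f g m * ?v m = (\<Sum>p\<in>{(a, b). a + b = m}. ?h p)"
      unfolding series_mult_def sum_distrib_right
      by (rule sum.cong) (auto simp: monomial_value_add mult_ac)
    also have "\<dots> = (\<Sum>p\<in>{p \<in> ?A \<times> ?B. ?s p = m}. ?h p)"
      by (rule sum.mono_neutral_right[OF finite_splittings]) auto
    finally show ?thesis .
  qed
  have "evaluate (series_mult f g) x = (\<Sum>m\<in>?s ` (?A \<times> ?B). series_mult f g m * ?v m)"
    unfolding evaluate_eq
  proof (rule Sum_any.expand_superset)
    show "{m. series_mult f g m * ?v m \<noteq> 0} \<subseteq> ?s ` (?A \<times> ?B)"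
    proof
      fix m assume "m \<in> {m. series_mult f g m * ?v m \<noteq> 0}"
      then have "(\<Sum>p\<in>{p \<in> ?A \<times> ?B. ?s p = m}. ?h p) \<noteq> 0" unfolding val by simp
      then have "{p \<in> ?A \<times> ?B. ?s p = m} \<noteq> {}" by (rule contrapos_nn) (simp only: sum.empty)
      then show "m \<in> ?s ` (?A \<times> ?B)" by blast
    qed
  qed (use fin in simp)
  also have "\<dots> = (\<Sum>p\<in>?A \<times> ?B. ?h p)"
    unfolding val using fin by (intro sum.group) auto
  also have "\<dots> = evaluate f x * evaluate g x"
    using fin by (simp add: evaluate_eq Sum_any.expand_set sum_product sum.cartesian_product case_prod_unfold)
  finally show ?thesis .
qed

text \<open>Evaluation respects the generation of \<open>Gamma\<close>, and distinctness of the
  parts lets sums over the list become sums over its set.\<close>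

lemma eval_at_partition_filtered:
  assumes "f \<in> Gamma"
  shows "\<exists>d F. filtered d F \<and> (\<forall>\<mu>. strict_partition \<mu> \<longrightarrow> eval_at_partition f \<mu> = F (set \<mu>))"
  using assms
proof induction
  case (const c)
  then show ?case using filtered.const by (auto simp: eval_at_partition_def evaluate_const)
next
  case (power_sum r)
  have "eval_at_partition (power_sum r) \<mu> = set_power_sum r (set \<mu>)" if "strict_partition \<mu>" for \<mu>
  proof -
    have "eval_at_partition (power_sum r) \<mu> = (\<Sum>i<length \<mu>. of_nat (\<mu> ! i) ^ r)"
      unfolding eval_at_partition_def using power_sum
      by (subst evaluate_power_sum[of _ "{..<length \<mu>}"]) (auto intro: odd_pos)
    also have "\<dots> = set_power_sum r (set \<mu>)"
      unfolding set_power_sum_def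
      using that by (intro sum.reindex_bij_betw bij_betw_nth) (auto simp: strict_partition_def)
    finally show ?thesis .
  qed
  then show ?case using filtered.psum[OF power_sum] by blast
next
  case (add f g)
  then obtain d F e G where F: "filtered d F" "\<And>\<mu>. strict_partition \<mu> \<Longrightarrow> eval_at_partition f \<mu> = F (set \<mu>)"
    and G: "filtered e G" "\<And>\<mu>. strict_partition \<mu> \<Longrightarrow> eval_at_partition g \<mu> = G (set \<mu>)"
    by metis
  have "filtered (max d e) (\<lambda>S. F S + G S)"
    by (intro filtered.add filtered.mono[OF F(1)] filtered.mono[OF G(1)]) auto
  moreover have "eval_at_partition (series_add f g) \<mu> = eval_at_partition f \<mu> + eval_at_partition g \<mu>" for \<mu>
    unfolding eval_at_partition_def
    using add Gamma_subset_symmetric_functions by (intro evaluate_add) auto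
  ultimately show ?case using F G by (intro exI[of _ "max d e"] exI[of _ "\<lambda>S. F S + G S"]) auto
next
  case (mult f g)
  then obtain d F e G where F: "filtered d F" "\<And>\<mu>. strict_partition \<mu> \<Longrightarrow> eval_at_partition f \<mu> = F (set \<mu>)"
    and G: "filtered e G" "\<And>\<mu>. strict_partition \<mu> \<Longrightarrow> eval_at_partition g \<mu> = G (set \<mu>)"
    by metis
  have "eval_at_partition (series_mult f g) \<mu> = eval_at_partition f \<mu> * eval_at_partition g \<mu>" for \<mu>
    unfolding eval_at_partition_def
    using mult Gamma_subset_symmetric_functions by (intro evaluate_mult) auto
  then show ?case using filtered.mult[OF F(1) G(1)] F G
    by (intro exI[of _ "d + e"] exI[of _ "\<lambda>S. F S * G S"]) auto
qed

theorem theorem1p2: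
  fixes f :: series
  assumes "f \<in> Gamma"
  shows "\<exists>\<Phi> :: rat poly. \<forall>n :: nat. expectation n f = poly \<Phi> (of_nat n)"
proof -
  obtain d F where "filtered d F" "\<And>\<mu>. strict_partition \<mu> \<Longrightarrow> eval_at_partition f \<mu> = F (set \<mu>)"
    using eval_at_partition_filtered[OF assms] by blast
  then show ?thesis using average_polynomial[of d F] expectation_eq_average[of f F] by simp
qed

end
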